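(* Let $G$ be a finite group, let $U$ be a projective unitary representation of $G$ on a finite-dimensional Hilbert space $\mathcal H$, and let $|\psi\rangle,|\phi\rangle\in\mathcal H$ be arbitrary pure states satisfying $G_{\psi,0}\subset G_{\phi,0}$. Then \[ R_{\mathrm{ap}}(\psi\to\phi)=\begin{cases}\infty & \text{if } \mathrm{Sym}_G(\psi)\subset\mathrm{Sym}_G(\phi),\\ 0 & \text{otherwise}.\end{cases} \]
   Context: A projective unitary representation $U$ of $G$ assigns unitaries $U(g)$ with $U(g)U(g')=e^{i\omega(g,g')}U(gg')$; write $\mathcal U_g(X)=U(g)XU(g)^\dagger$, and on $\mathcal H^{\otimes n}$ use $g\mapsto U(g)^{\otimes n}$. A CPTP map $\Lambda$ is covariant (w.r.t. input representation $\mathcal U_G$ and output representation $\mathcal U'_G$) if $\mathcal U'_g\circ\Lambda=\Lambda\circ\mathcal U_g$ for all $g\in G$. For a pure state, $\chi_\psi(g)=\langle\psi|U(g)|\psi\rangle$, $G_{\psi,0}:=\{g\in G:|\chi_\psi(g)|=1\}$, and $\mathrm{Sym}_G(\psi):=\{g\in G:U(g)\psi U(g)^\dagger=\psi\}$ with $\psi=|\psi\rangle\langle\psi|$. The approximate asymptotic conversion rate is $R_{\mathrm{ap}}(\psi\to\phi):=\sup\{r\ge0:$ there is a sequence $\epsilon_N\to0$ such that for every $N$ there is a covariant CPTP map $\Lambda_N$ (w.r.t. $U^{\otimes N}$ and $U^{\otimes\lfloor rN\rfloor}$) with $T(\phi^{\otimes\lfloor rN\rfloor},\Lambda_N(\psi^{\otimes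 N}))\le\epsilon_N\}$, where $T(\rho,\sigma)=\frac12\|\rho-\sigma\|_1$. *)

theory Defs
  imports Complex_Main "HOL-Algebra.Group" "HOL-Library.Extended_Real" "Jordan_Normal_Form.Matrix"
begin

definition adj :: "complex mat \<Rightarrow> complex mat" where
  "adj A = mat (dim_col A) (dim_row A) (\<lambda>(i,j). cnj (A $$ (j,i)))"

definition mtrace :: "complex mat \<Rightarrow> complex" where
  "mtrace A = (\<Sum>i<dim_row A. A $$ (i,i))"

definition unitary_mat :: "nat \<Rightarrow> complex mat \<Rightarrow> bool" where
  "unitary_mat n A \<longleftrightarrow> A \<in> carrier_mat n n \<and> adj A * A = 1\<^sub>m n"

definition psd :: "nat \<Rightarrow> complex mat \<Rightarrow> bool" where
  "psd n A \<longleftrightarrow> A \<in> carrier_mat n n \<and> adj A = A \<and>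
     (\<forall>x \<in> carrier_vec n. 0 \<le> Re (\<Sum>i<n. cnj (x $ i) * (A *\<^sub>v x) $ i))"

definition kron :: "complex mat \<Rightarrow> complex mat \<Rightarrow> complex mat" where
  "kron A B = mat (dim_row A * dim_row B) (dim_col A * dim_col B)
     (\<lambda>(i,j). A $$ (i div dim_row B, j div dim_col B) * B $$ (i mod dim_row B, j mod dim_col B))"

fun tpow :: "nat \<Rightarrow> complex mat \<Rightarrow> complex mat" where
  "tpow 0 A = 1\<^sub>m 1"
| "tpow (Suc n) A = kron A (tpow n A)"

definition proj :: "complex vec \<Rightarrow> complex mat" where
  "proj v = mat (dim_vec v) (dim_vec v) (\<lambda>(i,j). v $ i * cnj (v $ j))"

definition vnorm :: "complex vec \<Rightarrow> real" where
  "vnorm v = sqrt (\<Sum>i<dim_vec v. (cmod (v $ i))\<^sup>2)"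

definition abs_mat :: "complex mat \<Rightarrow> complex mat" where
  "abs_mat A = (THE B. psd (dim_col A) B \<and> B * B = adj A * A)"

definition trace_norm :: "complex mat \<Rightarrow> real" where
  "trace_norm A = Re (mtrace (abs_mat A))"

definition trace_dist :: "complex mat \<Rightarrow> complex mat \<Rightarrow> real" where
  "trace_dist \<rho> \<sigma> = trace_norm (\<rho> - \<sigma>) / 2"

definition lin_map :: "nat \<Rightarrow> nat \<Rightarrow> (complex mat \<Rightarrow> complex mat) \<Rightarrow> bool" where
  "lin_map n m \<Lambda> \<longleftrightarrow>
     (\<forall>X \<in> carrier_mat n n. \<Lambda> X \<in> carrier_mat m m) \<and>
     (\<forall>X \<in> carrier_mat n n. \<forall>Y \<in> carrier_mat n n. \<Lambda> (X + Y) = \<Lambda> X + \<Lambda> Y) \<and>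
     (\<forall>c. \<forall>X \<in> carrier_mat n n. \<Lambda> (c \<cdot>\<^sub>m X) = c \<cdot>\<^sub>m \<Lambda> X)"

text \<open>the (a,b) n x n block of a (k n) x (k n) matrix, and the ampliation id_k \<otimes> Lambda\<close>
definition blk :: "nat \<Rightarrow> complex mat \<Rightarrow> nat \<Rightarrow> nat \<Rightarrow> complex mat" where
  "blk n X a b = mat n n (\<lambda>(i,j). X $$ (a * n + i, b * n + j))"

definition ampl :: "nat \<Rightarrow> nat \<Rightarrow> nat \<Rightarrow> (complex mat \<Rightarrow> complex mat) \<Rightarrow> complex mat \<Rightarrow> complex mat" where
  "ampl k n m \<Lambda> X = mat (k * m) (k * m)
     (\<lambda>(i,j). \<Lambda> (blk n X (i div m) (j div m)) $$ (i mod m, j mod m))"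

definition completely_positive :: "nat \<Rightarrow> nat \<Rightarrow> (complex mat \<Rightarrow> complex mat) \<Rightarrow> bool" where
  "completely_positive n m \<Lambda> \<longleftrightarrow>
     (\<forall>k X. psd (k * n) X \<longrightarrow> psd (k * m) (ampl k n m \<Lambda> X))"

definition cptp :: "nat \<Rightarrow> nat \<Rightarrow> (complex mat \<Rightarrow> complex mat) \<Rightarrow> bool" where
  "cptp n m \<Lambda> \<longleftrightarrow> lin_map n m \<Lambda> \<and> completely_positive n m \<Lambda> \<and>
     (\<forall>X \<in> carrier_mat n n. mtrace (\<Lambda> X) = mtrace X)"

definition conj_by :: "complex mat \<Rightarrow> complex mat \<Rightarrow> complex mat" where
  "conj_by V X = V * X * adj V"

definition covariant ::
  "('g,'b) monoid_scheme \<Rightarrow> nat \<Rightarrow> ('g \<Rightarrow> complex mat) \<Rightarrow> ('g \<Rightarrow> complex mat)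
     \<Rightarrow> (complex mat \<Rightarrow> complex mat) \<Rightarrow> bool" where
  "covariant G n Uin Uout \<Lambda> \<longleftrightarrow>
     (\<forall>g \<in> carrier G. \<forall>X \<in> carrier_mat n n. \<Lambda> (conj_by (Uin g) X) = conj_by (Uout g) (\<Lambda> X))"

definition proj_unitary_rep :: "('g,'b) monoid_scheme \<Rightarrow> nat \<Rightarrow> ('g \<Rightarrow> complex mat) \<Rightarrow> bool" where
  "proj_unitary_rep G d U \<longleftrightarrow>
     (\<forall>g \<in> carrier G. unitary_mat d (U g)) \<and>
     (\<exists>\<omega> :: 'g \<Rightarrow> 'g \<Rightarrow> real. \<forall>g \<in> carrier G. \<forall>h \<in> carrier G.
        U g * U h = exp (\<i> * complex_of_real (\<omega> g h)) \<cdot>\<^sub>m U (g \<otimes>\<^bsub>G\<^esub> h))"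

definition chi :: "('g \<Rightarrow> complex mat) \<Rightarrow> complex vec \<Rightarrow> 'g \<Rightarrow> complex" where
  "chi U \<psi> g = (\<Sum>i<dim_vec \<psi>. cnj (\<psi> $ i) * (U g *\<^sub>v \<psi>) $ i)"

definition G0 :: "('g,'b) monoid_scheme \<Rightarrow> ('g \<Rightarrow> complex mat) \<Rightarrow> complex vec \<Rightarrow> 'g set" where
  "G0 G U \<psi> = {g \<in> carrier G. cmod (chi U \<psi> g) = 1}"

definition SymG :: "('g,'b) monoid_scheme \<Rightarrow> ('g \<Rightarrow> complex mat) \<Rightarrow> complex vec \<Rightarrow> 'g set" where
  "SymG G U \<psi> = {g \<in> carrier G. conj_by (U g) (proj \<psi>) = proj \<psi>}"

definition achievable_rates ::
  "('g,'b) monoid_scheme \<Rightarrow> nat \<Rightarrow> ('g \<Rightarrow> complex mat) \<Rightarrow> complex vec \<Rightarrow> complex vec \<Rightarrow> real set" where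
  "achievable_rates G d U \<psi> \<phi> = {r. 0 \<le> r \<and>
     (\<exists>\<epsilon> :: nat \<Rightarrow> real. \<epsilon> \<longlonglongrightarrow> 0 \<and>
        (\<forall>N. \<exists>\<Lambda>. cptp (d ^ N) (d ^ nat \<lfloor>r * real N\<rfloor>) \<Lambda> \<and>
           covariant G (d ^ N) (\<lambda>g. tpow N (U g)) (\<lambda>g. tpow (nat \<lfloor>r * real N\<rfloor>) (U g)) \<Lambda> \<and>
           trace_dist (tpow (nat \<lfloor>r * real N\<rfloor>) (proj \<phi>)) (\<Lambda> (tpow N (proj \<psi>))) \<le> \<epsilon> N))}"

definition R_ap ::
  "('g,'b) monoid_scheme \<Rightarrow> nat \<Rightarrow> ('g \<Rightarrow> complex mat) \<Rightarrow> complex vec \<Rightarrow> complex vec \<Rightarrow> ereal" where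
  "R_ap G d U \<psi> \<phi> = Sup (ereal ` achievable_rates G d U \<psi> \<phi>)"

end

theory Submission
  imports Defs "Jordan_Normal_Form.Spectral_Radius"
begin

text \<open>For unit vectors, the equality case of the Cauchy-Schwarz inequality shows that \<open>G0\<close> and
  \<open>SymG\<close> coincide, so under the hypothesis \<open>SymG \<psi> \<subseteq> SymG \<phi>\<close> always holds and it remains to achieve
  every rate. Put \<open>H = SymG \<psi>\<close>. The orbit of \<open>\<psi>\<close> under \<open>N\<close>-fold tensor powers has overlaps
  \<open>|chi (inv g h)| ^ N\<close>, which vanish as \<open>N\<close> grows unless \<open>g\<close> and \<open>h\<close> lie in the same left coset of
  \<open>H\<close>. Hence a covariant measurement identifies the coset with success probability at least
  \<open>|H| / s\<close>, where \<open>s = (\<Sum>g. |chi g| ^ N)\<close> tends to \<open>|H|\<close>. Preparing the correspondingly rotated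
  copies of \<open>\<phi>\<close>, in any number, is a covariant channel, and it does not depend on the representative
  of the coset because \<open>H\<close> fixes \<open>\<phi>\<close>. Vectors are represented by one-column matrices, so that
  \<open>tpow\<close> applies to them.\<close>

section \<open>Adjoints, traces and tensor powers\<close>

text \<open>The orbit vectors need not be orthogonal for any \<open>N\<close>, so the orbit
  projections alone are not a measurement. Their Gram matrix has entries of modulus
  \<open>|chi (inv g h)| ^ N\<close>; by left translation all its absolute row sums equal
  \<open>s\<close>, and Schur's test then bounds the sum of the projections by \<open>s\<close>.
  After division by \<open>s\<close> the missing part of the identity is positive and invariant, and
  an equal share of it goes to every outcome. Outcomes are labelled by group elements instead of
  cosets: no representatives are chosen, and each of the \<open>|H|\<close> correct outcomes has
  probability at least \<open>1 / s\<close>. A correct outcome yields the target exactly, so the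
  error is bounded by the failure probability whatever the number of output copies. The definitions
  account for most of the matrix theory. \<open>abs_mat\<close> is a definite description, so a
  trace norm can be evaluated only once positive square roots are known to exist and to be unique,
  which rests on the spectral theorem. Complete positivity quantifies over all ampliations and is
  reached through Kraus operators.\<close>

lemma adj_carrier [simp, intro]: "A \<in> carrier_mat n m \<Longrightarrow> adj A \<in> carrier_mat m n"
  by (auto simp: adj_def)

lemma adj_dim [simp]: "dim_row (adj A) = dim_col A" "dim_col (adj A) = dim_row A"
  by (auto simp: adj_def)

lemma adj_index [simp]: "i < dim_col A \<Longrightarrow> j < dim_row A \<Longrightarrow> adj A $$ (i,j) = cnj (A $$ (j,i))"
  by (auto simp: adj_def)

lemma adj_adj [simp]: "adj (adj A) = A"
  by (rule eq_matI) auto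

text \<open>Competes with the simp rule \<open>index_mult_mat(1)\<close>, which turns an entry of a
  product into a scalar product of a row and a column. That rule is switched off wherever entries
  are wanted as plain sums.\<close>

lemma index_mult_mat_sum:
  assumes "i < dim_row A" "j < dim_col B" "dim_col A = dim_row B"
  shows "(A * B) $$ (i,j) = (\<Sum>k<dim_row B. A $$ (i,k) * B $$ (k,j))"
  using assms by (simp add: scalar_prod_def atLeast0LessThan)

text \<open>Side conditions on dimensions, unlike carrier memberships with free size variables, can
  be discharged by the simplifier, so products can be reassociated by rewriting.\<close>

lemma mat_mult_assoc:
  fixes A B C :: "complex mat"
  assumes "dim_col A = dim_row B" "dim_col B = dim_row C"
  shows "A * B * C = A * (B * C)"
  by (rule assoc_mult_mat[OF carrier_matI[OF refl assms(1)] carrier_matI[OF refl assms(2)] carrier_matI[OF refl refl]])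

lemma mat_smult_mult:
  fixes A B :: "complex mat"
  assumes "dim_col A = dim_row B"
  shows "(c \<cdot>\<^sub>m A) * B = c \<cdot>\<^sub>m (A * B)" "A * (c \<cdot>\<^sub>m B) = c \<cdot>\<^sub>m (A * B)"
  by (rule mult_smult_assoc_mat[OF carrier_matI[OF refl assms] carrier_matI[OF refl refl]],
      rule mult_smult_distrib[OF carrier_matI[OF refl assms] carrier_matI[OF refl refl]])

lemma mat_smult_smult: "c \<cdot>\<^sub>m (e \<cdot>\<^sub>m A) = (c * e :: complex) \<cdot>\<^sub>m A"
  by (rule eq_matI) auto

lemma mat_one_smult [simp]: "(1 :: complex) \<cdot>\<^sub>m A = A"
  by (rule eq_matI) auto

lemma adj_mult:
  assumes "dim_col A = dim_row B"
  shows "adj (A * B) = adj B * adj A"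
  by (rule eq_matI) (use assms in \<open>auto simp: index_mult_mat_sum mult.commute simp del: index_mult_mat(1)\<close>)

lemma adj_one [simp]: "adj (1\<^sub>m n) = 1\<^sub>m n"
  by (rule eq_matI) auto

lemma adj_smult: "adj (c \<cdot>\<^sub>m A) = cnj c \<cdot>\<^sub>m adj A"
  by (rule eq_matI) auto

lemma adj_add: "A \<in> carrier_mat n m \<Longrightarrow> B \<in> carrier_mat n m \<Longrightarrow> adj (A + B) = adj A + adj B"
  by (rule eq_matI) auto

lemma adj_minus: "A \<in> carrier_mat n m \<Longrightarrow> B \<in> carrier_mat n m \<Longrightarrow> adj (A - B) = adj A - adj B"
  by (rule eq_matI) auto

lemma mtrace_one [simp]: "mtrace (1\<^sub>m n) = of_nat n"
  by (simp add: mtrace_def)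

lemma mtrace_smult: "A \<in> carrier_mat n n \<Longrightarrow> mtrace (c \<cdot>\<^sub>m A) = c * mtrace A"
  by (simp add: mtrace_def sum_distrib_left)

lemma mtrace_add: "A \<in> carrier_mat n n \<Longrightarrow> B \<in> carrier_mat n n \<Longrightarrow> mtrace (A + B) = mtrace A + mtrace B"
  by (simp add: mtrace_def sum.distrib)

lemma mtrace_minus: "A \<in> carrier_mat n n \<Longrightarrow> B \<in> carrier_mat n n \<Longrightarrow> mtrace (A - B) = mtrace A - mtrace B"
  by (simp add: mtrace_def sum_subtractf)

lemma mtrace_adj: "A \<in> carrier_mat n n \<Longrightarrow> mtrace (adj A) = cnj (mtrace A)"
  by (simp add: mtrace_def)

lemma mtrace_mult:
  assumes "A \<in> carrier_mat n m" "B \<in> carrier_mat m n"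
  shows "mtrace (A * B) = (\<Sum>i<n. \<Sum>j<m. A $$ (i,j) * B $$ (j,i))"
  using assms by (auto simp: mtrace_def index_mult_mat_sum simp del: index_mult_mat(1) intro!: sum.cong)

lemma mtrace_comm:
  assumes "A \<in> carrier_mat n m" "B \<in> carrier_mat m n"
  shows "mtrace (A * B) = mtrace (B * A)"
  unfolding mtrace_mult[OF assms] mtrace_mult[OF assms(2,1)]
  by (subst sum.swap) (simp add: mult.commute)

text \<open>This is the Hilbert-Schmidt inner product; for one-column matrices it is the inner
  product of vectors, the form in which all overlaps below are written.\<close>

lemma mtrace_adj_mult:
  assumes "A \<in> carrier_mat n m" "B \<in> carrier_mat n m"
  shows "mtrace (adj A * B) = (\<Sum>i<m. \<Sum>j<n. cnj (A $$ (j,i)) * B $$ (j,i))"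
  using assms by (subst mtrace_mult[where n=m and m=n]) (auto intro!: sum.cong)

lemma mtrace_adj_self:
  assumes "A \<in> carrier_mat n m"
  shows "mtrace (adj A * A) = of_real (\<Sum>i<m. \<Sum>j<n. (cmod (A $$ (j,i)))\<^sup>2)"
  unfolding mtrace_adj_mult[OF assms assms] of_real_sum complex_norm_square
  by (simp only: mult.commute)

lemma mtrace_adj_self_nonneg: "A \<in> carrier_mat n m \<Longrightarrow> 0 \<le> Re (mtrace (adj A * A))"
  by (subst mtrace_adj_self) (auto intro!: sum_nonneg)

lemma mtrace_adj_self_zero:
  assumes A: "A \<in> carrier_mat n m" and "Re (mtrace (adj A * A)) = 0"
  shows "A = 0\<^sub>m n m"
proof (rule eq_matI)
  fix j i assume "j < dim_row (0\<^sub>m n m :: complex mat)" "i < dim_col (0\<^sub>m n m :: complex mat)"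
  then have "j < n" "i < m" by auto
  have "(\<Sum>i<m. \<Sum>j<n. (cmod (A $$ (j,i)))\<^sup>2) = 0"
    using assms(2) by (simp only: mtrace_adj_self[OF A] Re_complex_of_real)
  then have "(\<Sum>j<n. (cmod (A $$ (j,i)))\<^sup>2) = 0"
    using \<open>i < m\<close> by (subst (asm) sum_nonneg_eq_0_iff) (auto intro!: sum_nonneg)
  then have "(cmod (A $$ (j,i)))\<^sup>2 = 0"
    using \<open>j < n\<close> by (subst (asm) sum_nonneg_eq_0_iff) auto
  then show "A $$ (j,i) = 0\<^sub>m n m $$ (j,i)" using \<open>j < n\<close> \<open>i < m\<close> by simp
qed (use A in auto)

section \<open>Kronecker products and tensor powers\<close>

lemma kron_dim [simp]: "dim_row (kron A B) = dim_row A * dim_row B" "dim_col (kron A B) = dim_col A * dim_col B"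
  by (auto simp: kron_def)

lemma kron_carrier [simp, intro]:
  "A \<in> carrier_mat n m \<Longrightarrow> B \<in> carrier_mat n' m' \<Longrightarrow> kron A B \<in> carrier_mat (n * n') (m * m')"
  by (auto simp: kron_def)

lemma kron_index:
  assumes "i < dim_row A * dim_row B" "j < dim_col A * dim_col B"
  shows "kron A B $$ (i,j) = A $$ (i div dim_row B, j div dim_col B) * B $$ (i mod dim_row B, j mod dim_col B)"
  using assms by (simp add: kron_def)

lemma div_mod_less_times:
  fixes i n m :: nat
  assumes "i < n * m"
  shows "i div m < n" "i mod m < m"
  using assms by (auto simp: less_mult_imp_div_less) (metis mod_less_divisor mult_0_right not_gr0 not_less0)

lemma add_times_less:
  fixes a x k n :: nat
  assumes "a < k" "x < n"
  shows "a * n + x < k * n"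
  using assms by (metis Suc_leI add.commute add_less_cancel_right less_le_trans mult_Suc mult_le_mono1)

text \<open>Splits a composite index into the quotient and remainder by which \<open>kron\<close>,
  \<open>blk\<close> and \<open>ampl\<close> address their entries.\<close>

lemma sum_less_times:
  fixes f :: "nat \<Rightarrow> 'a::comm_monoid_add"
  shows "(\<Sum>i<n * m. f i) = (\<Sum>a<n. \<Sum>b<m. f (a * m + b))"
proof -
  have "(\<Sum>i<n * m. f i) = (\<Sum>a<n. sum f {a * m..<a * m + m})"
    by (simp add: sum.nat_group)
  also have "\<dots> = (\<Sum>a<n. \<Sum>b<m. f (a * m + b))"
  proof (rule sum.cong[OF refl])
    fix a show "sum f {a * m..<a * m + m} = (\<Sum>b<m. f (a * m + b))"
      using sum.shift_bounds_nat_ivl[of f 0 "a * m" m] by (simp add: atLeast0LessThan add.commute)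
  qed
  finally show ?thesis .
qed

lemma kron_mult:
  assumes A: "A \<in> carrier_mat a b" and C: "C \<in> carrier_mat b c"
    and B: "B \<in> carrier_mat a' b'" and D: "D \<in> carrier_mat b' c'"
  shows "kron A B * kron C D = kron (A * C) (B * D)"
proof (rule eq_matI)
  fix i j assume "i < dim_row (kron (A * C) (B * D))" "j < dim_col (kron (A * C) (B * D))"
  then have i: "i < a * a'" and j: "j < c * c'" using assms by auto
  note im = div_mod_less_times[OF i] and jm = div_mod_less_times[OF j]
  have "(kron A B * kron C D) $$ (i,j) = (\<Sum>k<b * b'. kron A B $$ (i,k) * kron C D $$ (k,j))"
    using assms i j by (subst index_mult_mat_sum) auto
  also have "\<dots> = (\<Sum>x<b. \<Sum>y<b'. (A $$ (i div a', x) * B $$ (i mod a', y)) * (C $$ (x, j div c') * D $$ (y, j mod c')))"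
    unfolding sum_less_times
  proof (intro sum.cong refl, goal_cases)
    case (1 x y)
    then show ?case using 1 assms i j add_times_less[of x _ y] by (simp add: kron_index)
  qed
  also have "\<dots> = (\<Sum>x<b. A $$ (i div a', x) * C $$ (x, j div c')) * (\<Sum>y<b'. B $$ (i mod a', y) * D $$ (y, j mod c'))"
    by (simp add: sum_product mult_ac)
  also have "\<dots> = kron (A * C) (B * D) $$ (i,j)"
    using assms i j im jm by (subst kron_index) (auto simp: index_mult_mat_sum simp del: index_mult_mat(1))
  finally show "(kron A B * kron C D) $$ (i,j) = kron (A * C) (B * D) $$ (i,j)" .
qed (use assms in auto)

lemma kron_adj: "adj (kron A B) = kron (adj A) (adj B)"
  by (rule eq_matI) (auto simp: kron_index div_mod_less_times)

lemma kron_smult: "kron (c \<cdot>\<^sub>m A) (e \<cdot>\<^sub>m B) = (c * e) \<cdot>\<^sub>m kron A B"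
  by (rule eq_matI) (auto simp: kron_index div_mod_less_times)

lemma kron_one: "kron (1\<^sub>m n) (1\<^sub>m m) = 1\<^sub>m (n * m)"
proof (rule eq_matI)
  fix i j assume "i < dim_row (1\<^sub>m (n * m) :: complex mat)" "j < dim_col (1\<^sub>m (n * m) :: complex mat)"
  then have i: "i < n * m" and j: "j < n * m" by auto
  have "i = j \<longleftrightarrow> i div m = j div m \<and> i mod m = j mod m" by (metis div_mult_mod_eq)
  then show "kron (1\<^sub>m n) (1\<^sub>m m) $$ (i,j) = 1\<^sub>m (n * m) $$ (i,j)"
    using i j div_mod_less_times[OF i] div_mod_less_times[OF j] by (auto simp: kron_index)
qed auto

lemma mtrace_kron:
  assumes "A \<in> carrier_mat n n" "B \<in> carrier_mat m m"
  shows "mtrace (kron A B) = mtrace A * mtrace B"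
proof -
  have "mtrace (kron A B) = (\<Sum>x<n. \<Sum>y<m. A $$ (x,x) * B $$ (y,y))"
    using assms unfolding mtrace_def kron_dim carrier_matD[OF assms(1)] carrier_matD[OF assms(2)] sum_less_times
  proof (intro sum.cong refl, goal_cases)
    case (1 x y)
    then show ?case using 1 assms add_times_less[of x _ y] by (simp add: kron_index)
  qed
  then show ?thesis using assms by (simp add: mtrace_def sum_product)
qed

lemma tpow_carrier [simp, intro]: "A \<in> carrier_mat n m \<Longrightarrow> tpow N A \<in> carrier_mat (n ^ N) (m ^ N)"
  by (induction N) auto

text \<open>Rectangular factors are allowed so that the rule also covers states as columns, their
  adjoints as rows, and the one-entry matrix \<open>adj x * U * x\<close>.\<close>

lemma tpow_mult:
  assumes "A \<in> carrier_mat a b" "B \<in> carrier_mat b c"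
  shows "tpow N (A * B) = tpow N A * tpow N B"
proof (induction N)
  case (Suc N)
  then show ?case using kron_mult[OF assms tpow_carrier[OF assms(1)] tpow_carrier[OF assms(2)]] by simp
qed simp

lemma tpow_adj: "tpow N (adj A) = adj (tpow N A)"
  by (induction N) (auto simp: kron_adj)

lemma tpow_one: "tpow N (1\<^sub>m n) = 1\<^sub>m (n ^ N)"
  by (induction N) (auto simp: kron_one)

lemma tpow_smult: "tpow N (c \<cdot>\<^sub>m A) = c ^ N \<cdot>\<^sub>m tpow N A"
  by (induction N) (auto simp: kron_smult)

lemma mtrace_tpow:
  assumes "A \<in> carrier_mat n n"
  shows "mtrace (tpow N A) = mtrace A ^ N"
proof (induction N)
  case (Suc N)
  then show ?case using mtrace_kron[OF assms tpow_carrier[OF assms]] by simp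
qed simp

section \<open>Diagonalization of Hermitian matrices\<close>

lemma conj_by_carrier [simp, intro]:
  "V \<in> carrier_mat m n \<Longrightarrow> X \<in> carrier_mat n n \<Longrightarrow> conj_by V X \<in> carrier_mat m m"
  by (auto simp: conj_by_def)

lemma adj_conj_by:
  assumes "V \<in> carrier_mat m n" "X \<in> carrier_mat n n"
  shows "adj (conj_by V X) = conj_by V (adj X)"
  using assms by (auto simp: conj_by_def adj_mult assoc_mult_mat[of V m n _ n _ m])

lemma conj_by_conj_by:
  assumes V: "V \<in> carrier_mat k m" and W: "W \<in> carrier_mat m n" and X: "X \<in> carrier_mat n n"
  shows "conj_by V (conj_by W X) = conj_by (V * W) X"
proof -
  have "V * (W * X * adj W) * adj V = V * (W * X * adj W * adj V)"
    using assms by (intro assoc_mult_mat[of _ k m _ m _ k]) auto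
  also have "W * X * adj W * adj V = W * X * (adj W * adj V)"
    using assms by (intro assoc_mult_mat[of _ m n _ m _ k]) auto
  also have "V * \<dots> = V * (W * X) * (adj W * adj V)"
    using assms by (intro assoc_mult_mat[symmetric, of _ k m _ n _ k]) auto
  also have "V * (W * X) = V * W * X"
    using assms by (intro assoc_mult_mat[symmetric, of _ k m _ n _ n]) auto
  finally show ?thesis using assms by (simp add: conj_by_def adj_mult)
qed

lemma conj_by_one: "X \<in> carrier_mat n n \<Longrightarrow> conj_by (1\<^sub>m n) X = X"
  by (simp add: conj_by_def)

lemma conj_by_smult:
  assumes "V \<in> carrier_mat m n" "X \<in> carrier_mat n n"
  shows "conj_by (c \<cdot>\<^sub>m V) X = (c * cnj c) \<cdot>\<^sub>m conj_by V X"
proof -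
  have "conj_by (c \<cdot>\<^sub>m V) X = c \<cdot>\<^sub>m (V * X) * (cnj c \<cdot>\<^sub>m adj V)"
    using assms by (simp add: conj_by_def adj_smult mat_smult_mult)
  also have "\<dots> = c \<cdot>\<^sub>m (V * X * (cnj c \<cdot>\<^sub>m adj V))"
    using assms by (intro mult_smult_assoc_mat[of _ m n _ m]) auto
  also have "V * X * (cnj c \<cdot>\<^sub>m adj V) = cnj c \<cdot>\<^sub>m (V * X * adj V)"
    using assms by (intro mult_smult_distrib[of _ m n _ m]) auto
  finally show ?thesis by (simp add: conj_by_def mat_smult_smult)
qed

lemma conj_by_smult_right:
  assumes "V \<in> carrier_mat m n" "X \<in> carrier_mat n n"
  shows "conj_by V (c \<cdot>\<^sub>m X) = c \<cdot>\<^sub>m conj_by V X"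
  using assms by (simp add: conj_by_def mult_smult_assoc_mat[of _ m n _ m] mult_smult_distrib[of _ m n _ n])

lemma conj_by_add:
  assumes "V \<in> carrier_mat m n" "X \<in> carrier_mat n n" "Y \<in> carrier_mat n n"
  shows "conj_by V (X + Y) = conj_by V X + conj_by V Y"
  using assms by (simp add: conj_by_def mult_add_distrib_mat[of _ m n _ n] add_mult_distrib_mat[of _ m n _ _ m])

lemma conj_by_minus:
  assumes "V \<in> carrier_mat m n" "X \<in> carrier_mat n n" "Y \<in> carrier_mat n n"
  shows "conj_by V (X - Y) = conj_by V X - conj_by V Y"
  using assms by (simp add: conj_by_def mult_minus_distrib_mat[of _ m n _ n] minus_mult_distrib_mat[of _ m n _ _ m])

section \<open>Unitary conjugation\<close>

lemma unitary_mat_carrier: "unitary_mat n V \<Longrightarrow> V \<in> carrier_mat n n"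
  by (simp add: unitary_mat_def)

lemma unitary_mat_adj_left: "unitary_mat n V \<Longrightarrow> adj V * V = 1\<^sub>m n"
  by (simp add: unitary_mat_def)

lemma unitary_mat_adj_right: "unitary_mat n V \<Longrightarrow> V * adj V = 1\<^sub>m n"
  by (auto simp: unitary_mat_def intro: mat_mult_left_right_inverse[of "adj V" n V])

lemma unitary_mat_adj: "unitary_mat n V \<Longrightarrow> unitary_mat n (adj V)"
  using unitary_mat_adj_right[of n V] by (auto simp: unitary_mat_def)

lemma unitary_mat_mult:
  assumes "unitary_mat n V" "unitary_mat n W"
  shows "unitary_mat n (V * W)"
proof -
  note c = unitary_mat_carrier[OF assms(1)] unitary_mat_carrier[OF assms(2)]
  have "adj (V * W) * (V * W) = adj W * (adj V * (V * W))"
    using c by (simp add: adj_mult assoc_mult_mat[of "adj W" n n "adj V" n "V * W" n])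
  also have "adj V * (V * W) = W"
    using c by (simp add: assoc_mult_mat[symmetric, of "adj V" n n V n W n] unitary_mat_adj_left[OF assms(1)])
  finally show ?thesis using c unitary_mat_adj_left[OF assms(2)] by (auto simp: unitary_mat_def)
qed

lemma conj_by_unitary_cancel:
  assumes "unitary_mat n V" "X \<in> carrier_mat n n"
  shows "conj_by (adj V) (conj_by V X) = X" "conj_by V (conj_by (adj V) X) = X"
  using assms unitary_mat_carrier[OF assms(1)]
  by (auto simp: conj_by_conj_by[where n=n and m=n and k=n] unitary_mat_adj_left unitary_mat_adj_right conj_by_one)

lemma conj_by_mult_unitary:
  assumes "unitary_mat n V" "X \<in> carrier_mat n n" "Y \<in> carrier_mat n n"
  shows "conj_by V X * conj_by V Y = conj_by V (X * Y)"
proof -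
  note c = unitary_mat_carrier[OF assms(1)] assms(2,3)
  have "V * X * adj V * (V * Y * adj V) = V * X * (adj V * (V * Y * adj V))"
    using c by (intro assoc_mult_mat[of _ n n _ n _ n]) auto
  also have "adj V * (V * Y * adj V) = adj V * V * (Y * adj V)"
    using c by (simp add: assoc_mult_mat[of _ n n _ n _ n])
  also have "\<dots> = Y * adj V" using c unitary_mat_adj_left[OF assms(1)] by simp
  also have "V * X * (Y * adj V) = V * (X * Y) * adj V"
    using c by (simp add: assoc_mult_mat[of _ n n _ n _ n])
  finally show ?thesis by (simp add: conj_by_def)
qed

lemma mtrace_conj_by:
  assumes "V \<in> carrier_mat m n" "X \<in> carrier_mat n n"
  shows "mtrace (conj_by V X) = mtrace (adj V * V * X)"
  using assms by (simp add: conj_by_def mtrace_comm[of "V * X" m n] assoc_mult_mat[of "adj V" n m V n X n])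

lemma mtrace_conj_by_unitary:
  assumes "unitary_mat n V" "X \<in> carrier_mat n n"
  shows "mtrace (conj_by V X) = mtrace X"
  using assms by (subst mtrace_conj_by[of _ n n]) (auto simp: unitary_mat_def)

section \<open>The spectral theorem by deflation\<close>

lemma unitary_mat_four_block:
  assumes "unitary_mat n V"
  shows "unitary_mat (Suc n) (four_block_mat (1\<^sub>m 1) (0\<^sub>m 1 n) (0\<^sub>m n 1) V)"
proof -
  let ?F = "four_block_mat (1\<^sub>m 1) (0\<^sub>m 1 n) (0\<^sub>m n 1) V"
  have V: "V \<in> carrier_mat n n" using assms by (rule unitary_mat_carrier)
  have a: "adj ?F = four_block_mat (1\<^sub>m 1) (0\<^sub>m 1 n) (0\<^sub>m n 1) (adj V)"
    using V by (intro eq_matI) (auto)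
  have "adj ?F * ?F = four_block_mat (1\<^sub>m 1) (0\<^sub>m 1 n) (0\<^sub>m n 1) (adj V * V)"
    unfolding a using V by (subst mult_four_block_mat[where ?nr1.0=1 and ?n1.0=1 and ?n2.0=n and ?nr2.0=n and ?nc1.0=1 and ?nc2.0=n]) auto
  also have "\<dots> = 1\<^sub>m (Suc n)"
    unfolding unitary_mat_adj_left[OF assms] by (intro eq_matI) auto
  finally show ?thesis using V by (auto simp: unitary_mat_def)
qed

text \<open>The witness is the Householder reflection that exchanges the first basis vector and \<open>v\<close>.\<close>

lemma unitary_with_first_column:
  assumes v: "v \<in> carrier_mat (Suc n) 1" and n: "adj v * v = 1\<^sub>m 1" and re: "Im (v $$ (0,0)) = 0"
  obtains W where "unitary_mat (Suc n) W" "adj W = W" "\<And>i. i < Suc n \<Longrightarrow> W $$ (i,0) = v $$ (i,0)"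
proof (cases "v $$ (0,0) = 1")
  case True
  \<comment> \<open>The reflection divides by \<open>1 - v $$ (0,0)\<close>, so this case is
    separate. Unit length leaves no room for other entries, \<open>v\<close> is the first basis
    vector, and the identity serves.\<close>
  have "(\<Sum>j<Suc n. (cmod (v $$ (j,0)))\<^sup>2) = 1"
    using mtrace_adj_self[OF v] unfolding n by (simp add: of_real_eq_1_iff[symmetric, where 'a=complex] del: of_real_eq_1_iff of_real_power)
  then have "(\<Sum>j<n. (cmod (v $$ (Suc j,0)))\<^sup>2) = 0"
    using True by (subst (asm) sum.lessThan_Suc_shift) auto
  then have z: "v $$ (Suc j,0) = 0" if "j < n" for j
    using that by (subst (asm) sum_nonneg_eq_0_iff) auto
  show ?thesis
  proof
    show "unitary_mat (Suc n) (1\<^sub>m (Suc n))" by (simp add: unitary_mat_def)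
    fix i assume "i < Suc n"
    then show "1\<^sub>m (Suc n) $$ (i,0) = v $$ (i,0)" using True z by (cases i) auto
  qed simp
next
  case False
  define m where "m = Suc n"
  define a where "a = Re (v $$ (0,0))"
  have a: "v $$ (0,0) = of_real a" using re by (simp add: a_def complex_eq_iff)
  have a1: "a \<noteq> 1" using False a by auto
  define e where "e = mat m 1 (\<lambda>(i,j). if i = 0 then 1 else (0::complex))"
  define u where "u = v - e"
  \<comment> \<open>The reflection along \<open>u\<close> subtracts \<open>2 / |u|^2\<close> times
    \<open>u * adj u\<close>. As \<open>v\<close> is a unit vector with real first entry
    \<open>a\<close>, \<open>|u|^2 = 2 - 2 a\<close>, hence this constant. Realness of
    \<open>a\<close> also gives \<open>c * cnj (u $$ (0,0)) = -1\<close>, which makes the first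
    column equal to \<open>e + u = v\<close>.\<close>
  define c where "c = complex_of_real (1 / (1 - a))"
  have cr: "cnj c = c" by (simp add: c_def)
  define P where "P = u * adj u"
  have u: "u \<in> carrier_mat m 1" and e: "e \<in> carrier_mat m 1" and v: "v \<in> carrier_mat m 1"
    using v by (auto simp: u_def e_def m_def)
  have P: "P \<in> carrier_mat m m" using u by (auto simp: P_def)
  have aP: "adj P = P" using u by (simp add: P_def adj_mult)
  have uu: "adj u * u = (2 - 2 * of_real a) \<cdot>\<^sub>m 1\<^sub>m 1"
  proof (rule eq_matI)
    have sp: "(\<Sum>k<m. if k = 0 then f k else 0) = (f 0 :: complex)" for f
      by (simp add: m_def)
    have "(\<Sum>k<m. cnj (v $$ (k,0)) * v $$ (k,0)) = (adj v * v) $$ (0,0)"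
      using v by (simp add: index_mult_mat_sum del: index_mult_mat(1))
    then have vv: "(\<Sum>k<m. cnj (v $$ (k,0)) * v $$ (k,0)) = 1" unfolding n by simp
    have "(adj u * u) $$ (0,0) = (\<Sum>k<m. cnj (u $$ (k,0)) * u $$ (k,0))"
      using u by (simp add: index_mult_mat_sum del: index_mult_mat(1))
    also have "\<dots> = (\<Sum>k<m. cnj (v $$ (k,0)) * v $$ (k,0) + (if k = 0 then 1 - v $$ (k,0) - cnj (v $$ (k,0)) else 0))"
      using v by (intro sum.cong) (auto simp: u_def e_def algebra_simps)
    also have "\<dots> = 2 - 2 * of_real a"
      unfolding sum.distrib vv sp by (simp add: a)
    finally show "(adj u * u) $$ (i,j) = ((2 - 2 * of_real a) \<cdot>\<^sub>m 1\<^sub>m 1) $$ (i,j)"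
      if "i < dim_row ((2 - 2 * complex_of_real a) \<cdot>\<^sub>m 1\<^sub>m 1)" "j < dim_col ((2 - 2 * complex_of_real a) \<cdot>\<^sub>m 1\<^sub>m 1)" for i j
      using that by simp
  qed (use u in auto)
  have "P * P = u * (adj u * u) * adj u"
    using u by (simp add: P_def mat_mult_assoc)
  also have "\<dots> = (2 - 2 * of_real a) \<cdot>\<^sub>m P"
    unfolding uu using u by (simp add: P_def mat_smult_mult)
  finally have PP: "P * P = (2 - 2 * of_real a) \<cdot>\<^sub>m P" .
  have c2: "c * (2 - 2 * of_real a) = 2"
    using a1 unfolding c_def by (simp add: field_simps flip: of_real_mult of_real_diff) (simp add: algebra_simps)
  define W where "W = 1\<^sub>m m - c \<cdot>\<^sub>m P"
  have W: "W \<in> carrier_mat m m" using P by (auto simp: W_def)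
  have aW: "adj W = W"
    unfolding W_def using P by (simp add: adj_minus[of _ m m] adj_smult aP cr)
  have "W * W = W * 1\<^sub>m m - W * (c \<cdot>\<^sub>m P)"
    unfolding W_def[of] using P by (intro mult_minus_distrib_mat[of _ m m _ m]) auto
  also have "W * (c \<cdot>\<^sub>m P) = c \<cdot>\<^sub>m (W * P)" using W P by (intro mult_smult_distrib) auto
  also have "W * P = P - c \<cdot>\<^sub>m (P * P)"
    unfolding W_def using P by (simp add: minus_mult_distrib_mat[of _ m m _ _ m] mult_smult_assoc_mat[of _ m m _ m])
  also have "\<dots> = P - 2 \<cdot>\<^sub>m P" unfolding PP by (simp add: mat_smult_smult c2)
  finally have "W * W = 1\<^sub>m m"
    using P W by (auto simp: W_def intro!: eq_matI)
  then have "unitary_mat m W" using W by (auto simp: unitary_mat_def aW)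
  moreover have "W $$ (i,0) = v $$ (i,0)" if "i < m" for i
  proof -
    have "P $$ (i,0) = u $$ (i,0) * cnj (u $$ (0,0))"
      using u that unfolding P_def by (subst index_mult_mat_sum) auto
    moreover have "u $$ (0,0) = of_real a - 1"
      using v a by (simp add: u_def e_def m_def)
    moreover have "c * (of_real a - 1) = -1"
      using a1 unfolding c_def by (simp add: field_simps)
    ultimately have "c * P $$ (i,0) = u $$ (i,0) * -1" by (metis complex_cnj_complex_of_real complex_cnj_diff complex_cnj_one mult.assoc mult.commute)
    then show ?thesis using that P v by (auto simp: W_def u_def e_def)
  qed
  ultimately show ?thesis using that aW by (auto simp: m_def)
qed


text \<open>A nonempty complex matrix has an eigenvector. Dividing by its length and rotating its
  phase gives the unit length and the real first entry that the reflection in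
  \<open>unitary_with_first_column\<close> requires.\<close>

lemma normalized_eigenvector:
  assumes A: "A \<in> carrier_mat (Suc n) (Suc n)"
  obtains v k where "v \<in> carrier_mat (Suc n) 1" "adj v * v = 1\<^sub>m 1" "Im (v $$ (0,0)) = 0" "A * v = k \<cdot>\<^sub>m v"
proof -
  obtain k where "eigenvalue A k" using spectrum_non_empty[OF A] by (auto simp: spectrum_def)
  then obtain w where "eigenvector A w k" by (auto simp: eigenvalue_def)
  then have w: "w \<in> carrier_vec (Suc n)" "w \<noteq> 0\<^sub>v (Suc n)" "A *\<^sub>v w = k \<cdot>\<^sub>v w"
    using A by (auto simp: eigenvector_def)
  define u where "u = mat (Suc n) 1 (\<lambda>(i,j). w $ i)"
  have u: "u \<in> carrier_mat (Suc n) 1" by (simp add: u_def)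
  have Au: "A * u = k \<cdot>\<^sub>m u"
  proof (rule eq_matI)
    fix i j assume "i < dim_row (k \<cdot>\<^sub>m u)" "j < dim_col (k \<cdot>\<^sub>m u)"
    then have ij: "i < Suc n" "j = 0" using u by auto
    have "(A * u) $$ (i,j) = (A *\<^sub>v w) $ i"
      using ij A w(1) by (simp add: u_def scalar_prod_def del: sum.op_ivl_Suc)
    then show "(A * u) $$ (i,j) = (k \<cdot>\<^sub>m u) $$ (i,j)" using ij w u by (simp add: u_def)
  qed (use A u in auto)
  have "u \<noteq> 0\<^sub>m (Suc n) 1"
  proof
    assume "u = 0\<^sub>m (Suc n) 1"
    then have "u $$ (i,0) = 0" if "i < Suc n" for i using that by simp
    then have "w = 0\<^sub>v (Suc n)" using w(1) by (intro eq_vecI) (auto simp: u_def)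
    with w show False by simp
  qed
  then have "Re (mtrace (adj u * u)) \<noteq> 0" using mtrace_adj_self_zero[OF u] by blast
  then have pos: "Re (mtrace (adj u * u)) > 0" using mtrace_adj_self_nonneg[OF u] by simp
  define t where "t = Re (mtrace (adj u * u))"
  have t: "mtrace (adj u * u) = of_real t" unfolding t_def mtrace_adj_self[OF u] by simp
  \<comment> \<open>The default 1 keeps \<open>p\<close> of modulus one when the first entry
    vanishes, where \<open>sgn\<close> would give 0.\<close>
  define p where "p = (if u $$ (0,0) = 0 then 1 else cnj (sgn (u $$ (0,0))))"
  have p: "cmod p = 1" by (simp add: p_def norm_sgn)
  have pu: "Im (p * u $$ (0,0)) = 0" by (simp add: p_def sgn_eq)
  define c where "c = of_real (1 / sqrt t) * p"
  have cc: "cnj c * c * of_real t = 1"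
  proof -
    have "cnj c * c * of_real t = of_real ((cmod c)\<^sup>2 * t)" 
      by (simp add: complex_norm_square mult.commute del: of_real_power)
    also have "(cmod c)\<^sup>2 * t = 1" using pos p by (simp add: c_def norm_mult norm_divide t_def[symmetric] power_divide)
    finally show ?thesis by simp
  qed
  show ?thesis
  proof
    show "c \<cdot>\<^sub>m u \<in> carrier_mat (Suc n) 1" using u by simp
    have "adj (c \<cdot>\<^sub>m u) * (c \<cdot>\<^sub>m u) = (cnj c * c) \<cdot>\<^sub>m (adj u * u)"
      using u by (simp add: adj_smult mat_smult_mult mat_smult_smult mult.commute)
    moreover have "(cnj c * c) * (adj u * u) $$ (0,0) = 1"
      using t cc u by (simp add: mtrace_def)
    ultimately show "adj (c \<cdot>\<^sub>m u) * (c \<cdot>\<^sub>m u) = 1\<^sub>m 1" using u by (intro eq_matI) auto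
    show "Im ((c \<cdot>\<^sub>m u) $$ (0,0)) = 0" using u pu by (simp add: c_def mult.assoc)
    show "A * (c \<cdot>\<^sub>m u) = k \<cdot>\<^sub>m (c \<cdot>\<^sub>m u)" using u A Au by (simp add: mat_smult_mult mat_smult_smult mult.commute)
  qed
qed

lemma conj_by_four_block:
  assumes "V \<in> carrier_mat n n" "A \<in> carrier_mat n n" "a \<in> carrier_mat 1 1"
  shows "conj_by (four_block_mat (1\<^sub>m 1) (0\<^sub>m 1 n) (0\<^sub>m n 1) V) (four_block_mat a (0\<^sub>m 1 n) (0\<^sub>m n 1) A)
    = four_block_mat a (0\<^sub>m 1 n) (0\<^sub>m n 1) (conj_by V A)"
proof -
  have a: "adj (four_block_mat (1\<^sub>m 1) (0\<^sub>m 1 n) (0\<^sub>m n 1) V) = four_block_mat (1\<^sub>m 1) (0\<^sub>m 1 n) (0\<^sub>m n 1) (adj V)"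
    using assms by (intro eq_matI) auto
  show ?thesis
    unfolding conj_by_def a using assms
    by (simp add: mult_four_block_mat[where ?nr1.0=1 and ?n1.0=1 and ?n2.0=n and ?nr2.0=n and ?nc1.0=1 and ?nc2.0=n])
      (rule arg_cong[where f="four_block_mat _ _ _"], rule left_add_zero_mat[of _ n n], auto)
qed

lemma diagonal_mat_four_block:
  assumes "diagonal_mat A" "A \<in> carrier_mat n n" "a \<in> carrier_mat 1 1"
  shows "diagonal_mat (four_block_mat a (0\<^sub>m 1 n) (0\<^sub>m n 1) A)"
  using assms by (auto simp: diagonal_mat_def)

text \<open>Deflation: a self-adjoint unitary \<open>W\<close> carries the first basis vector to a
  unit eigenvector, so the first column of \<open>W * A * W\<close> is \<open>k\<close> times that
  basis vector. By Hermiticity the first row vanishes off the diagonal too, and the remaining block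
  is smaller and Hermitian.\<close>

theorem hermitian_diagonalizable:
  assumes "A \<in> carrier_mat n n" "adj A = A"
  shows "\<exists>V. unitary_mat n V \<and> diagonal_mat (conj_by V A)"
  using assms
proof (induction n arbitrary: A)
  case 0
  then show ?case by (intro exI[of _ "1\<^sub>m 0"]) (auto simp: unitary_mat_def diagonal_mat_def conj_by_def)
next
  case (Suc n)
  obtain v k where v: "v \<in> carrier_mat (Suc n) 1" "adj v * v = 1\<^sub>m 1" "Im (v $$ (0,0)) = 0" "A * v = k \<cdot>\<^sub>m v"
    using normalized_eigenvector[OF Suc.prems(1)] .
  obtain W where W: "unitary_mat (Suc n) W" "adj W = W" "\<And>i. i < Suc n \<Longrightarrow> W $$ (i,0) = v $$ (i,0)"
    using unitary_with_first_column[OF v(1-3)] by blast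
  have Wc: "W \<in> carrier_mat (Suc n) (Suc n)" using W(1) by (rule unitary_mat_carrier)
  note A = Suc.prems(1)
  define B where "B = conj_by W A"
  have B: "B \<in> carrier_mat (Suc n) (Suc n)" using Wc A by (auto simp: B_def)
  have aB: "adj B = B" using Wc A Suc.prems(2) by (simp add: B_def adj_conj_by)
  have col: "B $$ (i,0) = (if i = 0 then k else 0)" if "i < Suc n" for i
  proof -
    have "(A * W) $$ (j,0) = k * W $$ (j,0)" if "j < Suc n" for j
    proof -
      have "(A * W) $$ (j,0) = (A * v) $$ (j,0)"
        using that A Wc v(1) W(3) by (simp add: index_mult_mat_sum del: index_mult_mat(1))
      then show ?thesis using v(1,4) W(3) that by simp
    qed
    then have "B $$ (i,0) = (\<Sum>j<Suc n. W $$ (i,j) * (k * W $$ (j,0)))"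
      using that A Wc W(2) unfolding B_def conj_by_def
      by (simp add: mat_mult_assoc index_mult_mat_sum del: index_mult_mat(1) sum.lessThan_Suc)
    also have "\<dots> = k * (W * W) $$ (i,0)"
      using that Wc by (simp add: index_mult_mat_sum sum_distrib_left mult_ac del: index_mult_mat(1) sum.lessThan_Suc)
    also have "W * W = 1\<^sub>m (Suc n)" using unitary_mat_adj_left[OF W(1)] W(2) by simp
    finally show ?thesis using that by simp
  qed
  have row: "B $$ (0,i) = (if i = 0 then k else 0)" if "i < Suc n" for i
  proof -
    have "B $$ (0,i) = cnj (B $$ (i,0))" using that B by (subst aB[symmetric]) simp
    then show ?thesis using col[of i] col[of 0] that by auto
  qed
  define C where "C = mat n n (\<lambda>(i,j). B $$ (Suc i, Suc j))"
  have C: "C \<in> carrier_mat n n" by (simp add: C_def)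
  have "adj C = C"
  proof (rule eq_matI)
    fix i j assume "i < dim_row C" "j < dim_col C"
    then show "adj C $$ (i,j) = C $$ (i,j)"
      using B arg_cong[OF aB, of "\<lambda>M. M $$ (Suc i, Suc j)"] by (simp add: C_def)
  qed (use C in auto)
  then obtain V where V: "unitary_mat n V" "diagonal_mat (conj_by V C)" using Suc.IH[OF C] by auto
  define K where "K = mat 1 1 (\<lambda>_. k)"
  have BC: "B = four_block_mat K (0\<^sub>m 1 n) (0\<^sub>m n 1) C"
  proof (rule eq_matI)
    fix i j assume "i < dim_row (four_block_mat K (0\<^sub>m 1 n) (0\<^sub>m n 1) C)" "j < dim_col (four_block_mat K (0\<^sub>m 1 n) (0\<^sub>m n 1) C)"
    then have "i < Suc n" "j < Suc n" using C by (auto simp: K_def)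
    then show "B $$ (i,j) = four_block_mat K (0\<^sub>m 1 n) (0\<^sub>m n 1) C $$ (i,j)"
      using col row C by (cases i; cases j) (auto simp: K_def C_def)
  qed (use B C in \<open>auto simp: K_def\<close>)
  let ?F = "four_block_mat (1\<^sub>m 1) (0\<^sub>m 1 n) (0\<^sub>m n 1) V"
  have F: "unitary_mat (Suc n) ?F" using V(1) by (rule unitary_mat_four_block)
  have "conj_by (?F * W) A = conj_by ?F B"
    unfolding B_def using unitary_mat_carrier[OF F] Wc A by (simp add: conj_by_conj_by)
  also have "\<dots> = four_block_mat K (0\<^sub>m 1 n) (0\<^sub>m n 1) (conj_by V C)"
    unfolding BC using V C by (intro conj_by_four_block) (auto simp: K_def unitary_mat_def)
  finally have "diagonal_mat (conj_by (?F * W) A)"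
    using diagonal_mat_four_block[OF V(2) conj_by_carrier[OF unitary_mat_carrier[OF V(1)] C], of K]
    by (simp add: K_def)
  then show ?case using unitary_mat_mult[OF F W(1)] by blast
qed

section \<open>Positive semidefinite matrices and the trace norm\<close>

text \<open>The dimensions are parameters because the type \<open>complex mat\<close> contains
  matrices of all sizes, and even an empty sum must have a definite size.\<close>

definition msum :: "nat \<Rightarrow> nat \<Rightarrow> ('i \<Rightarrow> complex mat) \<Rightarrow> 'i set \<Rightarrow> complex mat" where
  "msum n m f S = mat n m (\<lambda>(i,j). \<Sum>g\<in>S. f g $$ (i,j))"

lemma msum_carrier [simp, intro]: "msum n m f S \<in> carrier_mat n m"
  by (simp add: msum_def)

lemma msum_dim [simp]: "dim_row (msum n m f S) = n" "dim_col (msum n m f S) = m"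
  by (simp_all add: msum_def)

lemma msum_index [simp]: "i < n \<Longrightarrow> j < m \<Longrightarrow> msum n m f S $$ (i,j) = (\<Sum>g\<in>S. f g $$ (i,j))"
  by (simp add: msum_def)

lemma msum_cong: "S = T \<Longrightarrow> (\<And>g. g \<in> T \<Longrightarrow> f g = h g) \<Longrightarrow> msum n m f S = msum n m h T"
  by (auto simp: msum_def intro!: eq_matI sum.cong)

lemma msum_reindex: "inj_on h S \<Longrightarrow> msum n m f (h ` S) = msum n m (\<lambda>x. f (h x)) S"
  by (auto simp: msum_def sum.reindex intro!: eq_matI)

lemma msum_smult:
  assumes "\<And>g. g \<in> S \<Longrightarrow> f g \<in> carrier_mat n m"
  shows "msum n m (\<lambda>g. c \<cdot>\<^sub>m f g) S = c \<cdot>\<^sub>m msum n m f S"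
proof (rule eq_matI)
  fix i j assume "i < dim_row (c \<cdot>\<^sub>m msum n m f S)" "j < dim_col (c \<cdot>\<^sub>m msum n m f S)"
  then have ij: "i < n" "j < m" by auto
  have "(c \<cdot>\<^sub>m f g) $$ (i,j) = c * f g $$ (i,j)" if "g \<in> S" for g
    using assms[OF that] ij by simp
  then show "msum n m (\<lambda>g. c \<cdot>\<^sub>m f g) S $$ (i,j) = (c \<cdot>\<^sub>m msum n m f S) $$ (i,j)"
    using ij by (simp add: sum_distrib_left)
qed auto

lemma msum_add:
  assumes "\<And>g. g \<in> S \<Longrightarrow> f g \<in> carrier_mat n m" "\<And>g. g \<in> S \<Longrightarrow> h g \<in> carrier_mat n m"
  shows "msum n m (\<lambda>g. f g + h g) S = msum n m f S + msum n m h S"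
proof (rule eq_matI)
  fix i j assume "i < dim_row (msum n m f S + msum n m h S)" "j < dim_col (msum n m f S + msum n m h S)"
  then have ij: "i < n" "j < m" by auto
  have "(f g + h g) $$ (i,j) = f g $$ (i,j) + h g $$ (i,j)" if "g \<in> S" for g
    using assms[OF that] ij by simp
  then show "msum n m (\<lambda>g. f g + h g) S $$ (i,j) = (msum n m f S + msum n m h S) $$ (i,j)"
    using ij by (simp add: sum.distrib)
qed auto

lemma msum_mult_left:
  assumes A: "A \<in> carrier_mat k n" and f: "\<And>g. g \<in> S \<Longrightarrow> f g \<in> carrier_mat n m"
  shows "A * msum n m f S = msum k m (\<lambda>g. A * f g) S"
proof (rule eq_matI)
  fix i j assume "i < dim_row (msum k m (\<lambda>g. A * f g) S)" "j < dim_col (msum k m (\<lambda>g. A * f g) S)"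
  then have ij: "i < k" "j < m" by auto
  have "(A * msum n m f S) $$ (i,j) = (\<Sum>l<n. \<Sum>g\<in>S. A $$ (i,l) * f g $$ (l,j))"
    using A ij by (subst index_mult_mat_sum) (auto simp: sum_distrib_left)
  also have "\<dots> = (\<Sum>g\<in>S. \<Sum>l<n. A $$ (i,l) * f g $$ (l,j))" by (rule sum.swap)
  also have "\<dots> = (\<Sum>g\<in>S. (A * f g) $$ (i,j))"
    using A f ij by (intro sum.cong refl, subst index_mult_mat_sum) auto
  finally show "(A * msum n m f S) $$ (i,j) = msum k m (\<lambda>g. A * f g) S $$ (i,j)" using ij by simp
qed (use A in auto)

lemma msum_mult_right:
  assumes A: "A \<in> carrier_mat m k" and f: "\<And>g. g \<in> S \<Longrightarrow> f g \<in> carrier_mat n m"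
  shows "msum n m f S * A = msum n k (\<lambda>g. f g * A) S"
proof (rule eq_matI)
  fix i j assume "i < dim_row (msum n k (\<lambda>g. f g * A) S)" "j < dim_col (msum n k (\<lambda>g. f g * A) S)"
  then have ij: "i < n" "j < k" by auto
  have "(msum n m f S * A) $$ (i,j) = (\<Sum>l<m. \<Sum>g\<in>S. f g $$ (i,l) * A $$ (l,j))"
    using A ij by (subst index_mult_mat_sum) (auto simp: sum_distrib_right)
  also have "\<dots> = (\<Sum>g\<in>S. \<Sum>l<m. f g $$ (i,l) * A $$ (l,j))" by (rule sum.swap)
  also have "\<dots> = (\<Sum>g\<in>S. (f g * A) $$ (i,j))"
  proof (intro sum.cong refl)
    fix g assume "g \<in> S"
    then show "(\<Sum>l<m. f g $$ (i,l) * A $$ (l,j)) = (f g * A) $$ (i,j)"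
      using A f[OF \<open>g \<in> S\<close>] ij by (subst index_mult_mat_sum) auto
  qed
  finally show "(msum n m f S * A) $$ (i,j) = msum n k (\<lambda>g. f g * A) S $$ (i,j)" using ij by simp
qed (use A in auto)

lemma adj_msum:
  assumes "\<And>g. g \<in> S \<Longrightarrow> f g \<in> carrier_mat n m"
  shows "adj (msum n m f S) = msum m n (\<lambda>g. adj (f g)) S"
proof (rule eq_matI)
  fix i j assume "i < dim_row (msum m n (\<lambda>g. adj (f g)) S)" "j < dim_col (msum m n (\<lambda>g. adj (f g)) S)"
  then have ij: "i < m" "j < n" by auto
  have "adj (f g) $$ (i,j) = cnj (f g $$ (j,i))" if "g \<in> S" for g
    using assms[OF that] ij by simp
  then show "adj (msum n m f S) $$ (i,j) = msum m n (\<lambda>g. adj (f g)) S $$ (i,j)"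
    using ij by simp
qed auto

lemma mtrace_msum:
  assumes "\<And>g. g \<in> S \<Longrightarrow> f g \<in> carrier_mat n n"
  shows "mtrace (msum n n f S) = (\<Sum>g\<in>S. mtrace (f g))"
proof -
  have "mtrace (msum n n f S) = (\<Sum>i<n. \<Sum>g\<in>S. f g $$ (i,i))" by (simp add: mtrace_def)
  also have "\<dots> = (\<Sum>g\<in>S. \<Sum>i<n. f g $$ (i,i))" by (rule sum.swap)
  finally show ?thesis using assms by (auto simp: mtrace_def intro!: sum.cong)
qed

lemma conj_by_msum:
  assumes V: "V \<in> carrier_mat m n" and f: "\<And>g. g \<in> S \<Longrightarrow> f g \<in> carrier_mat n n"
  shows "conj_by V (msum n n f S) = msum m m (\<lambda>g. conj_by V (f g)) S"
proof -
  have "V * msum n n f S = msum m n (\<lambda>g. V * f g) S" by (rule msum_mult_left[OF V f])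
  moreover have "msum m n (\<lambda>g. V * f g) S * adj V = msum m m (\<lambda>g. V * f g * adj V) S"
    by (rule msum_mult_right[OF adj_carrier[OF V]]) (use V f in auto)
  ultimately show ?thesis by (simp add: conj_by_def)
qed

lemma conj_by_index:
  assumes "V \<in> carrier_mat m n" "X \<in> carrier_mat n n" "i < m" "j < m"
  shows "conj_by V X $$ (i,j) = (\<Sum>a<n. \<Sum>b<n. V $$ (i,a) * X $$ (a,b) * cnj (V $$ (j,b)))"
proof -
  have "conj_by V X = V * (X * adj V)" using assms by (simp add: conj_by_def mat_mult_assoc)
  then have "conj_by V X $$ (i,j) = (\<Sum>a<n. V $$ (i,a) * (X * adj V) $$ (a,j))"
    using assms by (subst \<open>conj_by V X = _\<close>, subst index_mult_mat_sum) auto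
  also have "\<dots> = (\<Sum>a<n. V $$ (i,a) * (\<Sum>b<n. X $$ (a,b) * cnj (V $$ (j,b))))"
    using assms by (intro sum.cong refl, subst index_mult_mat_sum) auto
  finally show ?thesis by (simp add: sum_distrib_left mult.assoc)
qed

lemma mtrace_1_1: "A \<in> carrier_mat 1 1 \<Longrightarrow> mtrace A = A $$ (0,0)"
  by (simp add: mtrace_def)

lemma mtrace_conj_by_row:
  assumes "y \<in> carrier_mat 1 n" "A \<in> carrier_mat n n"
  shows "mtrace (conj_by y A) = (\<Sum>i<n. \<Sum>j<n. y $$ (0,i) * A $$ (i,j) * cnj (y $$ (0,j)))"
  using assms by (subst mtrace_1_1) (auto simp: conj_by_index[of _ 1 n])

text \<open>Taking the test vector as the row \<open>y\<close> of its conjugated entries turns the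
  quadratic form into the trace of a congruence, so the rules for \<open>conj_by\<close> and
  \<open>mtrace\<close> apply to positivity.\<close>

lemma psd_iff:
  "psd n A \<longleftrightarrow> A \<in> carrier_mat n n \<and> adj A = A \<and> (\<forall>y \<in> carrier_mat 1 n. 0 \<le> Re (mtrace (conj_by y A)))"
proof -
  have e: "(\<Sum>i<n. cnj (x $ i) * (A *\<^sub>v x) $ i) = (\<Sum>i<n. \<Sum>j<n. cnj (x $ i) * A $$ (i,j) * x $ j)"
    if "x \<in> carrier_vec n" "A \<in> carrier_mat n n" for x
    using that by (intro sum.cong refl) (simp add: scalar_prod_def sum_distrib_left atLeast0LessThan mult.assoc)
  show ?thesis
  proof (intro iffI conjI ballI)
    fix y :: "complex mat" assume p: "psd n A" and y: "y \<in> carrier_mat 1 n"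
    then have A: "A \<in> carrier_mat n n" by (simp add: psd_def)
    have "0 \<le> Re (\<Sum>i<n. cnj (vec n (\<lambda>i. cnj (y $$ (0,i))) $ i) * (A *\<^sub>v vec n (\<lambda>i. cnj (y $$ (0,i)))) $ i)"
      using p unfolding psd_def by (blast intro: vec_carrier)
    then show "0 \<le> Re (mtrace (conj_by y A))"
      unfolding mtrace_conj_by_row[OF y A] by (subst (asm) e) (use A in auto)
  next
    assume r: "A \<in> carrier_mat n n \<and> adj A = A \<and> (\<forall>y \<in> carrier_mat 1 n. 0 \<le> Re (mtrace (conj_by y A)))"
    have "0 \<le> Re (\<Sum>i<n. cnj (x $ i) * (A *\<^sub>v x) $ i)" if x: "x \<in> carrier_vec n" for x
    proof -
      define y where "y = mat 1 n (\<lambda>(i,j). cnj (x $ j))"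
      have y: "y \<in> carrier_mat 1 n" by (simp add: y_def)
      have "0 \<le> Re (mtrace (conj_by y A))" using r y by blast
      then show ?thesis
        using r unfolding mtrace_conj_by_row[OF y conjunct1[OF r]] by (subst e[OF x]) (auto simp: y_def)
    qed
    then show "psd n A" using r by (simp add: psd_def)
  qed (auto simp: psd_def)
qed

lemma psd_carrier: "psd n A \<Longrightarrow> A \<in> carrier_mat n n"
  by (simp add: psd_def)

lemma psd_adj: "psd n A \<Longrightarrow> adj A = A"
  by (simp add: psd_def)

lemma psd_conj_by:
  assumes "psd n A" "V \<in> carrier_mat m n"
  shows "psd m (conj_by V A)"
  unfolding psd_iff
proof (intro conjI ballI)
  have A: "A \<in> carrier_mat n n" "adj A = A" using assms by (auto simp: psd_def)
  show "conj_by V A \<in> carrier_mat m m" using A assms by auto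
  show "adj (conj_by V A) = conj_by V A" using A assms by (simp add: adj_conj_by)
  fix y :: "complex mat" assume y: "y \<in> carrier_mat 1 m"
  have "y * V \<in> carrier_mat 1 n" using y assms by auto
  then show "0 \<le> Re (mtrace (conj_by y (conj_by V A)))"
    using assms unfolding conj_by_conj_by[OF y assms(2) A(1)] by (auto simp: psd_iff)
qed

lemma psd_add: "psd n A \<Longrightarrow> psd n B \<Longrightarrow> psd n (A + B)"
  unfolding psd_iff
  by (auto simp: adj_add[of _ n n] conj_by_add[of _ 1 n] mtrace_add[OF conj_by_carrier[of _ 1 n] conj_by_carrier[of _ 1 n]])

lemma psd_smult: "psd n A \<Longrightarrow> 0 \<le> c \<Longrightarrow> psd n (of_real c \<cdot>\<^sub>m A)"
  unfolding psd_iff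
  by (auto simp: adj_smult conj_by_smult_right[of _ 1 n] mtrace_smult[OF conj_by_carrier[of _ 1 n]])

lemma psd_msum:
  assumes "\<And>g. g \<in> S \<Longrightarrow> psd n (f g)"
  shows "psd n (msum n n f S)"
  unfolding psd_iff
proof (intro conjI ballI)
  have c: "f g \<in> carrier_mat n n" if "g \<in> S" for g using assms[OF that] by (rule psd_carrier)
  show "adj (msum n n f S) = msum n n f S"
    using assms by (subst adj_msum[OF c]) (auto intro!: msum_cong simp: psd_def)
  fix y :: "complex mat" assume y: "y \<in> carrier_mat 1 n"
  have "mtrace (conj_by y (msum n n f S)) = (\<Sum>g\<in>S. mtrace (conj_by y (f g)))"
    by (subst conj_by_msum[OF y]) (use y c in \<open>auto intro!: mtrace_msum\<close>)
  then show "0 \<le> Re (mtrace (conj_by y (msum n n f S)))"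
    using assms y by (auto simp: psd_iff intro!: sum_nonneg)
qed auto

lemma psd_one: "psd n (1\<^sub>m n)"
  unfolding psd_iff
proof (intro conjI ballI)
  fix y :: "complex mat" assume "y \<in> carrier_mat 1 n"
  then show "0 \<le> Re (mtrace (conj_by y (1\<^sub>m n)))"
    using mtrace_adj_self_nonneg[of "adj y" n 1] by (simp add: conj_by_def)
qed auto

lemma psd_outer: "x \<in> carrier_mat n m \<Longrightarrow> psd n (x * adj x)"
  using psd_conj_by[OF psd_one, of x n m] by (simp add: conj_by_def)

lemma psd_diag:
  assumes A: "psd n A" and i: "i < n"
  shows "Im (A $$ (i,i)) = 0" "0 \<le> Re (A $$ (i,i))"
proof -
  have "A $$ (i,i) = cnj (A $$ (i,i))"
    using psd_adj[OF A] psd_carrier[OF A] i by (metis adj_index carrier_matD)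
  then show "Im (A $$ (i,i)) = 0" by (simp add: complex_eq_iff)
  define y where "y = mat 1 n (\<lambda>(k,j). if j = i then 1 else (0::complex))"
  have y: "y \<in> carrier_mat 1 n" by (simp add: y_def)
  have "mtrace (conj_by y A) = A $$ (i,i)"
  proof -
    have "mtrace (conj_by y A) = (\<Sum>k<n. \<Sum>j<n. if j = i then (if k = i then A $$ (k,j) else 0) else 0)"
      unfolding mtrace_conj_by_row[OF y psd_carrier[OF A]] by (intro sum.cong refl) (auto simp: y_def)
    then show ?thesis using i by simp
  qed
  then show "0 \<le> Re (A $$ (i,i))" using A y by (metis psd_iff)
qed

lemma psd_mtrace:
  assumes A: "psd n A"
  shows "Im (mtrace A) = 0" "0 \<le> Re (mtrace A)"
  using psd_diag[OF A] psd_carrier[OF A] by (auto simp: mtrace_def intro!: sum_nonneg)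

lemma psd_diagonal:
  assumes D: "D \<in> carrier_mat n n" "diagonal_mat D" and nn: "\<And>i. i < n \<Longrightarrow> Im (D $$ (i,i)) = 0 \<and> 0 \<le> Re (D $$ (i,i))"
  shows "psd n D"
  unfolding psd_iff
proof (intro conjI ballI)
  define r where "r i = Re (D $$ (i,i))" for i
  have z: "D $$ (i,j) = (if j = i then of_real (r i) else 0)" if "i < n" "j < n" for i j
    using that D nn by (auto simp: diagonal_mat_def complex_eq_iff r_def)
  show "adj D = D"
    by (rule eq_matI) (use D in \<open>auto simp: z\<close>)
  fix y :: "complex mat" assume y: "y \<in> carrier_mat 1 n"
  have "mtrace (conj_by y D) = (\<Sum>i<n. \<Sum>j<n. if j = i then y $$ (0,i) * of_real (r i) * cnj (y $$ (0,j)) else 0)"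
    unfolding mtrace_conj_by_row[OF y D(1)] by (intro sum.cong refl) (auto simp: z)
  also have "\<dots> = (\<Sum>i<n. of_real ((cmod (y $$ (0,i)))\<^sup>2 * r i))"
    by (intro sum.cong refl) (simp add: complex_norm_square mult_ac del: of_real_power)
  finally show "0 \<le> Re (mtrace (conj_by y D))" using nn by (auto intro!: sum_nonneg simp: r_def)
qed (rule D)

text \<open>In an eigenbasis the trace is a sum of nonnegative diagonal entries, so a zero trace
  kills each of them.\<close>

lemma psd_mtrace_zero:
  assumes A: "psd n A" and "Re (mtrace A) = 0"
  shows "A = 0\<^sub>m n n"
proof -
  obtain V where V: "unitary_mat n V" "diagonal_mat (conj_by V A)"
    using hermitian_diagonalizable[OF psd_carrier[OF A] psd_adj[OF A]] by blast
  note Vc = unitary_mat_carrier[OF V(1)]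
  have p: "psd n (conj_by V A)" by (rule psd_conj_by[OF A Vc])
  have "mtrace (conj_by V A) = mtrace A" by (rule mtrace_conj_by_unitary[OF V(1) psd_carrier[OF A]])
  moreover have "Re (mtrace (conj_by V A)) = (\<Sum>i<n. Re (conj_by V A $$ (i,i)))"
    using psd_carrier[OF p] by (simp add: mtrace_def)
  ultimately have "(\<Sum>i<n. Re (conj_by V A $$ (i,i))) = 0"
    using assms(2) by simp
  then have d: "conj_by V A $$ (i,i) = 0" if "i < n" for i
    using that psd_diag[OF p] by (subst (asm) sum_nonneg_eq_0_iff) (auto simp: complex_eq_iff)
  have "conj_by V A = 0\<^sub>m n n"
  proof (rule eq_matI)
    fix i j assume "i < dim_row (0\<^sub>m n n :: complex mat)" "j < dim_col (0\<^sub>m n n :: complex mat)"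
    then show "conj_by V A $$ (i,j) = 0\<^sub>m n n $$ (i,j)"
      using d V(2) psd_carrier[OF p] by (cases "i = j") (auto simp: diagonal_mat_def)
  qed (use psd_carrier[OF p] in auto)
  then have "A = conj_by (adj V) (0\<^sub>m n n)"
    using conj_by_unitary_cancel(1)[OF V(1) psd_carrier[OF A]] by simp
  then show ?thesis using Vc by (simp add: conj_by_def)
qed

text \<open>If A and B are positive with equal squares and C = A - B, then AC + CB = 0, so the traces
  of CAC and CBC add up to 0. Both are positive, hence vanish, and C^3 = CAC - CBC = 0.\<close>

lemma psd_square_inject:
  assumes A: "psd n A" and B: "psd n B" and eq: "A * A = B * B"
  shows "A = B"
proof -
  note c = psd_carrier[OF A] psd_carrier[OF B]
  define C where "C = A - B"
  have C: "C \<in> carrier_mat n n" using c by (auto simp: C_def)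
  have aC: "adj C = C" using c psd_adj[OF A] psd_adj[OF B] by (simp add: C_def adj_minus)
  have pA: "psd n (conj_by C A)" and pB: "psd n (conj_by C B)"
    using psd_conj_by[OF A C] psd_conj_by[OF B C] .
  have "A * C + C * B = 0\<^sub>m n n"
  proof -
    have "A * C = A * A - A * B" unfolding C_def using c by (intro mult_minus_distrib_mat) auto
    moreover have "C * B = A * B - B * B" unfolding C_def using c by (intro minus_mult_distrib_mat) auto
    moreover have "X - Y + (Y - X) = 0\<^sub>m n n" if "X \<in> carrier_mat n n" "Y \<in> carrier_mat n n" for X Y :: "complex mat"
      using that by (intro eq_matI) auto
    ultimately show ?thesis unfolding eq using c by simp
  qed
  then have "C * (A * C) + C * (C * B) = C * 0\<^sub>m n n"
    using c C by (simp add: mult_add_distrib_mat[of C n n "A * C" n "C * B", symmetric])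
  then have z: "C * (A * C) + C * (C * B) = 0\<^sub>m n n" using C by simp
  have "mtrace (C * (A * C)) + mtrace (C * (C * B)) = 0"
    using c C by (subst mtrace_add[symmetric, of _ n]) (auto simp: z, simp add: mtrace_def)
  moreover have "mtrace (C * (C * B)) = mtrace (conj_by C B)"
    using c C mtrace_comm[of C n n "C * B"] by (simp add: conj_by_def aC)
  moreover have "mtrace (C * (A * C)) = mtrace (conj_by C A)"
    using c C by (simp add: conj_by_def aC mat_mult_assoc)
  ultimately have "mtrace (conj_by C A) + mtrace (conj_by C B) = 0" by simp
  then have s: "Re (mtrace (conj_by C A)) + Re (mtrace (conj_by C B)) = 0" by (metis plus_complex.sel(1) zero_complex.sel(1))
  have "conj_by C A = 0\<^sub>m n n" "conj_by C B = 0\<^sub>m n n"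
    using psd_mtrace_zero[OF pA] psd_mtrace_zero[OF pB] psd_mtrace(2)[OF pA] psd_mtrace(2)[OF pB] s by auto
  then have "conj_by C C = 0\<^sub>m n n"
    using c C conj_by_minus[OF C c] by (simp add: C_def[symmetric])
  then have CCC: "C * (C * C) = 0\<^sub>m n n" using C by (simp add: conj_by_def aC mat_mult_assoc)
  \<comment> \<open>Since \<open>C\<close> is Hermitian, the squared Hilbert-Schmidt norm of
    \<open>C * C\<close> is the trace of the fourth power, which vanishes with the third. The same
    argument, one level down, then gives \<open>C = 0\<close>.\<close>
  have "adj (C * C) * (C * C) = C * (C * (C * C))"
    using C by (simp add: adj_mult aC mat_mult_assoc)
  also have "\<dots> = 0\<^sub>m n n" unfolding CCC using C by simp
  finally have "C * C = 0\<^sub>m n n"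
    using mtrace_adj_self_zero[of "C * C" n n] C by (simp add: mtrace_def)
  then have "C = 0\<^sub>m n n"
    using mtrace_adj_self_zero[of C n n] C by (simp add: mtrace_def aC)
  then have "(A - B) $$ (i,j) = 0" if "i < n" "j < n" for i j using that by (simp add: C_def)
  then show ?thesis using c by (intro eq_matI) auto
qed

section \<open>Square roots, absolute values and a trace norm estimate\<close>

lemma diagonal_mat_square:
  fixes D :: "complex mat"
  assumes "D \<in> carrier_mat n n" "diagonal_mat D"
  shows "D * D = mat n n (\<lambda>(i,j). if i = j then (D $$ (i,i))\<^sup>2 else 0)"
proof (rule eq_matI)
  fix i j assume "i < dim_row (mat n n (\<lambda>(i,j). if i = j then (D $$ (i,i))\<^sup>2 else 0))" "j < dim_col (mat n n (\<lambda>(i,j). if i = j then (D $$ (i,i))\<^sup>2 else 0))"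
  then have ij: "i < n" "j < n" by auto
  have "(D * D) $$ (i,j) = (\<Sum>k<n. D $$ (i,k) * D $$ (k,j))"
    using assms ij by (subst index_mult_mat_sum) auto
  also have "\<dots> = (\<Sum>k<n. if k = i then D $$ (i,i) * D $$ (i,j) else 0)"
    using assms ij by (intro sum.cong refl) (auto simp: diagonal_mat_def)
  also have "\<dots> = D $$ (i,i) * D $$ (i,j)" using ij by simp
  finally show "(D * D) $$ (i,j) = mat n n (\<lambda>(i,j). if i = j then (D $$ (i,i))\<^sup>2 else 0) $$ (i,j)"
    using ij assms by (auto simp: diagonal_mat_def power2_eq_square)
qed (use assms in auto)

lemma psd_sqrt:
  assumes A: "psd n A"
  obtains B where "psd n B" "B * B = A"
proof -
  obtain V where V: "unitary_mat n V" "diagonal_mat (conj_by V A)"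
    using hermitian_diagonalizable[OF psd_carrier[OF A] psd_adj[OF A]] by blast
  note Vc = unitary_mat_carrier[OF V(1)]
  define D where "D = conj_by V A"
  have p: "psd n D" unfolding D_def by (rule psd_conj_by[OF A Vc])
  define E where "E = mat n n (\<lambda>(i,j). if i = j then complex_of_real (sqrt (Re (D $$ (i,i)))) else 0)"
  have E: "E \<in> carrier_mat n n" "diagonal_mat E" by (auto simp: E_def diagonal_mat_def)
  have pE: "psd n E" using psd_diag[OF p] by (intro psd_diagonal E) (auto simp: E_def)
  have "E * E = D"
    unfolding diagonal_mat_square[OF E]
  proof (rule eq_matI)
    fix i j assume "i < dim_row D" "j < dim_col D"
    then have ij: "i < n" "j < n" using psd_carrier[OF p] by auto
    have "(complex_of_real (sqrt (Re (D $$ (i,i)))))\<^sup>2 = D $$ (i,i)"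
      using psd_diag[OF p ij(1)] by (simp add: complex_eq_iff flip: of_real_power)
    then show "mat n n (\<lambda>(i,j). if i = j then (E $$ (i,i))\<^sup>2 else 0) $$ (i,j) = D $$ (i,j)"
      using ij V(2) psd_carrier[OF p] by (auto simp: E_def D_def diagonal_mat_def)
  qed (use psd_carrier[OF p] in auto)
  moreover have "conj_by (adj V) E * conj_by (adj V) E = conj_by (adj V) (E * E)"
    using unitary_mat_adj[OF V(1)] E by (intro conj_by_mult_unitary) auto
  moreover have "conj_by (adj V) D = A"
    unfolding D_def by (rule conj_by_unitary_cancel(1)[OF V(1) psd_carrier[OF A]])
  ultimately show ?thesis
    using that psd_conj_by[OF pE adj_carrier[OF Vc]] by simp
qed

text \<open>Uniqueness of positive square roots makes the definite description in
  \<open>abs_mat\<close> usable: any candidate with the right square is the absolute value.\<close>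

lemma abs_mat_eqI:
  assumes "A \<in> carrier_mat n n" "psd n B" "B * B = adj A * A"
  shows "abs_mat A = B"
  unfolding abs_mat_def
proof (rule the_equality)
  show "psd (dim_col A) B \<and> B * B = adj A * A" using assms by simp
  fix C assume "psd (dim_col A) C \<and> C * C = adj A * A"
  then show "C = B" using assms psd_square_inject[of n C B] by simp
qed

text \<open>The triangle inequality for \<open>P\<close> and \<open>- Q\<close>. In an eigenbasis of
  \<open>P - Q\<close> the trace norm is the sum of the moduli of differences of diagonal entries of
  \<open>P\<close> and \<open>Q\<close>; these entries are nonnegative, so each modulus is at most
  their sum.\<close>

lemma trace_norm_minus_le:
  assumes P: "psd n P" and Q: "psd n Q"
  shows "trace_norm (P - Q) \<le> Re (mtrace P) + Re (mtrace Q)"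
proof -
  note c = psd_carrier[OF P] psd_carrier[OF Q]
  define A where "A = P - Q"
  have A: "A \<in> carrier_mat n n" "adj A = A"
    using c psd_adj[OF P] psd_adj[OF Q] by (auto simp: A_def adj_minus)
  obtain V where V: "unitary_mat n V" "diagonal_mat (conj_by V A)"
    using hermitian_diagonalizable[OF A] by blast
  note Vc = unitary_mat_carrier[OF V(1)]
  define D where "D = conj_by V A"
  have D: "D \<in> carrier_mat n n" "diagonal_mat D" using V(2) Vc A by (auto simp: D_def)
  define p q where "p = conj_by V P" and "q = conj_by V Q"
  have pq: "psd n p" "psd n q" using psd_conj_by[OF P Vc] psd_conj_by[OF Q Vc] by (auto simp: p_def q_def)
  have "D = p - q" unfolding D_def A_def p_def q_def by (rule conj_by_minus[OF Vc c])
  then have Dii: "D $$ (i,i) = p $$ (i,i) - q $$ (i,i)" if "i < n" for i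
    using that psd_carrier[OF pq(1)] psd_carrier[OF pq(2)] by simp
  define E where "E = mat n n (\<lambda>(i,j). if i = j then complex_of_real (cmod (D $$ (i,i))) else 0)"
  have E: "E \<in> carrier_mat n n" "diagonal_mat E" by (auto simp: E_def diagonal_mat_def)
  have pE: "psd n E" by (intro psd_diagonal E) (auto simp: E_def)
  have "E * E = D * D"
    unfolding diagonal_mat_square[OF E] diagonal_mat_square[OF D]
  proof (intro cong_mat refl)
    fix i j assume ij: "i < n" "j < n"
    \<comment> \<open>The eigenvalue must be real, for otherwise its square would differ from the
      square of its modulus.\<close>
    have "Im (D $$ (i,i)) = 0" using Dii ij psd_diag[OF pq(1)] psd_diag[OF pq(2)] by simp
    then have "(complex_of_real (cmod (D $$ (i,i))))\<^sup>2 = (D $$ (i,i))\<^sup>2"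
      by (metis complex_is_Real_iff norm_of_real of_real_power power2_abs Reals_cases)
    then show "(case (i,j) of (i,j) \<Rightarrow> if i = j then (E $$ (i,i))\<^sup>2 else 0) = (case (i,j) of (i,j) \<Rightarrow> if i = j then (D $$ (i,i))\<^sup>2 else 0)"
      using ij by (auto simp: E_def)
  qed
  moreover have "conj_by (adj V) E * conj_by (adj V) E = conj_by (adj V) (E * E)"
    using unitary_mat_adj[OF V(1)] E by (intro conj_by_mult_unitary) auto
  moreover have "conj_by (adj V) (D * D) = conj_by (adj V) D * conj_by (adj V) D"
    using unitary_mat_adj[OF V(1)] D by (intro conj_by_mult_unitary[symmetric]) auto
  moreover have "conj_by (adj V) D = A"
    unfolding D_def by (rule conj_by_unitary_cancel(1)[OF V(1) A(1)])
  ultimately have "abs_mat A = conj_by (adj V) E"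
    using psd_conj_by[OF pE adj_carrier[OF Vc]] A by (intro abs_mat_eqI) auto
  then have "trace_norm A = Re (mtrace E)"
    using mtrace_conj_by_unitary[OF unitary_mat_adj[OF V(1)] E(1)] by (simp add: trace_norm_def)
  also have "\<dots> = (\<Sum>i<n. cmod (D $$ (i,i)))" using E by (simp add: mtrace_def) (simp add: E_def)
  also have "\<dots> \<le> (\<Sum>i<n. Re (p $$ (i,i)) + Re (q $$ (i,i)))"
  proof (rule sum_mono)
    fix i assume "i \<in> {..<n}"
    then have i: "i < n" by simp
    have "cmod (D $$ (i,i)) = \<bar>Re (D $$ (i,i))\<bar>"
      using Dii[OF i] psd_diag[OF pq(1) i] psd_diag[OF pq(2) i] by (simp add: cmod_eq_Re)
    then show "cmod (D $$ (i,i)) \<le> Re (p $$ (i,i)) + Re (q $$ (i,i))"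
      using Dii[OF i] psd_diag[OF pq(1) i] psd_diag[OF pq(2) i] by simp
  qed
  also have "\<dots> = Re (mtrace p) + Re (mtrace q)"
    using psd_carrier[OF pq(1)] psd_carrier[OF pq(2)] by (simp add: mtrace_def sum.distrib)
  also have "\<dots> = Re (mtrace P) + Re (mtrace Q)"
    by (simp add: p_def q_def mtrace_conj_by_unitary[OF V(1)] c)
  finally show ?thesis by (simp add: A_def)
qed

section \<open>Measure-and-prepare channels\<close>

lemma blk_carrier [simp]: "blk n X a b \<in> carrier_mat n n"
  by (simp add: blk_def)

lemma ampl_msum:
  "ampl k n m (\<lambda>X. msum m m (\<lambda>g. L g X) S) X = msum (k * m) (k * m) (\<lambda>g. ampl k n m (L g) X) S"
  by (rule eq_matI) (auto simp: ampl_def div_mod_less_times)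

lemma completely_positive_msum:
  assumes "\<And>g. g \<in> S \<Longrightarrow> completely_positive n m (L g)"
  shows "completely_positive n m (\<lambda>X. msum m m (\<lambda>g. L g X) S)"
  using assms unfolding completely_positive_def ampl_msum by (auto intro: psd_msum)

text \<open>Agreement on n x n matrices suffices because \<open>ampl\<close> applies its map only to
  blocks, and \<open>blk\<close> always has this size.\<close>

lemma completely_positive_cong:
  assumes "\<And>X. X \<in> carrier_mat n n \<Longrightarrow> L X = L' X"
  shows "completely_positive n m L \<longleftrightarrow> completely_positive n m L'"
  by (simp add: completely_positive_def ampl_def assms)

text \<open>Row \<open>i\<close> of the Kronecker product of the identity with \<open>K\<close> is
  supported in block \<open>i div m\<close>. The function \<open>h\<close> stands for the identity
  or for \<open>cnj\<close>, as the row and the column side of a congruence need;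
  \<open>h 0 = 0\<close> preserves the zero blocks.\<close>

lemma sum_kron_one_row:
  assumes K: "K \<in> carrier_mat m n" and i: "i < k * m" and h: "h 0 = 0"
  shows "(\<Sum>p<k * n. h (kron (1\<^sub>m k) K $$ (i,p)) * f p) = (\<Sum>x<n. (h (K $$ (i mod m, x)) :: complex) * f ((i div m) * n + x))"
proof -
  have "(\<Sum>p<k * n. h (kron (1\<^sub>m k) K $$ (i,p)) * f p)
    = (\<Sum>a<k. if a = i div m then \<Sum>x<n. h (K $$ (i mod m, x)) * f (a * n + x) else 0)"
    unfolding sum_less_times
  proof (rule sum.cong[OF refl])
    fix a assume a: "a \<in> {..<k}"
    have "kron (1\<^sub>m k) K $$ (i, a * n + x) = (if a = i div m then K $$ (i mod m, x) else 0)" if "x < n" for x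
      using a that K i add_times_less[of a k x n] div_mod_less_times[OF i] by (subst kron_index) auto
    then show "(\<Sum>x<n. h (kron (1\<^sub>m k) K $$ (i, a * n + x)) * f (a * n + x))
      = (if a = i div m then \<Sum>x<n. h (K $$ (i mod m, x)) * f (a * n + x) else 0)"
      by (simp add: h)
  qed
  also have "\<dots> = (\<Sum>x<n. h (K $$ (i mod m, x)) * f ((i div m) * n + x))"
    using div_mod_less_times[OF i] by simp
  finally show ?thesis .
qed

text \<open>Ampliating conjugation by \<open>K\<close> gives conjugation by the identity tensor
  \<open>K\<close>, so complete positivity of a single Kraus term reduces to invariance of
  positivity under congruence.\<close>

lemma ampl_conj_by:
  assumes K: "K \<in> carrier_mat m n" and X: "X \<in> carrier_mat (k * n) (k * n)"
  shows "ampl k n m (conj_by K) X = conj_by (kron (1\<^sub>m k) K) X"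
proof (rule eq_matI)
  have V: "kron (1\<^sub>m k) K \<in> carrier_mat (k * m) (k * n)" using K by auto
  let ?V = "kron (1\<^sub>m k) K"
  show "dim_row (ampl k n m (conj_by K) X) = dim_row (conj_by ?V X)"
    "dim_col (ampl k n m (conj_by K) X) = dim_col (conj_by ?V X)"
    using conj_by_carrier[OF V X] by (auto simp: ampl_def)
  fix i j assume "i < dim_row (conj_by ?V X)" "j < dim_col (conj_by ?V X)"
  then have i: "i < k * m" and j: "j < k * m" using conj_by_carrier[OF V X] by auto
  let ?i = "i div m" and ?j = "j div m"
  have "conj_by ?V X $$ (i,j) = (\<Sum>a<k * n. ?V $$ (i,a) * (\<Sum>b<k * n. cnj (?V $$ (j,b)) * X $$ (a,b)))"
    by (subst conj_by_index[OF V X i j]) (simp add: sum_distrib_left mult_ac)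
  also have "\<dots> = (\<Sum>x<n. K $$ (i mod m, x) * (\<Sum>y<n. cnj (K $$ (j mod m, y)) * X $$ (?i * n + x, ?j * n + y)))"
    unfolding sum_kron_one_row[OF K j, of cnj, simplified]
    by (rule sum_kron_one_row[OF K i, of "\<lambda>z. z", simplified])
  also have "\<dots> = conj_by K (blk n X ?i ?j) $$ (i mod m, j mod m)"
    using div_mod_less_times[OF i] div_mod_less_times[OF j]
    by (subst conj_by_index[OF K blk_carrier]) (auto simp: blk_def sum_distrib_left mult_ac)
  finally show "ampl k n m (conj_by K) X $$ (i,j) = conj_by ?V X $$ (i,j)"
    using i j by (simp add: ampl_def)
qed

lemma completely_positive_conj_by:
  assumes "K \<in> carrier_mat m n"
  shows "completely_positive n m (conj_by K)"
  unfolding completely_positive_def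
proof (intro allI impI)
  fix k X assume X: "psd (k * n) X"
  have "kron (1\<^sub>m k) K \<in> carrier_mat (k * m) (k * n)" using assms by auto
  then show "psd (k * m) (ampl k n m (conj_by K) X)"
    using psd_conj_by[OF X] ampl_conj_by[OF assms psd_carrier[OF X]] by simp
qed

text \<open>With B the square root of the effect E, the rows of B give the Kraus operators.\<close>

lemma completely_positive_measure_prepare:
  assumes E: "psd n E" and w: "w \<in> carrier_mat m 1"
  shows "completely_positive n m (\<lambda>X. mtrace (E * X) \<cdot>\<^sub>m (w * adj w))"
proof -
  obtain B where B: "psd n B" "B * B = E" using psd_sqrt[OF E] .
  note Bc = psd_carrier[OF B(1)]
  define R where "R i = mat 1 n (\<lambda>(k,j). B $$ (i,j))" for i
  have R: "R i \<in> carrier_mat 1 n" for i by (simp add: R_def)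
  have wR: "w * R i \<in> carrier_mat m n" for i using w R by auto
  have F: "w * adj w \<in> carrier_mat m m" using w by auto
  have "completely_positive n m (\<lambda>X. msum m m (\<lambda>i. conj_by (w * R i) X) {..<n})"
    by (intro completely_positive_msum completely_positive_conj_by wR)
  moreover have "msum m m (\<lambda>i. conj_by (w * R i) X) {..<n} = mtrace (E * X) \<cdot>\<^sub>m (w * adj w)"
    if X: "X \<in> carrier_mat n n" for X
  proof -
    \<comment> \<open>Conjugating by row \<open>i\<close> of \<open>B\<close> picks out a diagonal
      entry of \<open>B * X * B\<close>. Summed over \<open>i\<close> this is its trace, which by
      cyclicity is the outcome weight \<open>mtrace (E * X)\<close>.\<close>
    have RX: "conj_by (R i) X = (conj_by B X $$ (i,i)) \<cdot>\<^sub>m 1\<^sub>m 1" if "i < n" for i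
    proof (rule eq_matI)
      fix a b assume "a < dim_row (conj_by B X $$ (i,i) \<cdot>\<^sub>m 1\<^sub>m 1)" "b < dim_col (conj_by B X $$ (i,i) \<cdot>\<^sub>m 1\<^sub>m 1)"
      then have ab: "a = 0" "b = 0" by auto
      have "conj_by (R i) X $$ (0,0) = conj_by B X $$ (i,i)"
        using that by (subst conj_by_index[OF R X]) (simp_all add: conj_by_index[OF Bc X] R_def)
      then show "conj_by (R i) X $$ (a,b) = (conj_by B X $$ (i,i) \<cdot>\<^sub>m 1\<^sub>m 1) $$ (a,b)" using ab by simp
    qed (use conj_by_carrier[OF R X] in auto)
    have "conj_by (w * R i) X = (conj_by B X $$ (i,i)) \<cdot>\<^sub>m (w * adj w)" if "i < n" for i
    proof -
      have "conj_by (w * R i) X = conj_by w (conj_by B X $$ (i,i) \<cdot>\<^sub>m 1\<^sub>m 1)"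
        by (simp only: conj_by_conj_by[OF w R X, symmetric] RX[OF that])
      also have "\<dots> = conj_by B X $$ (i,i) \<cdot>\<^sub>m conj_by w (1\<^sub>m 1)"
        by (rule conj_by_smult_right[OF w]) simp
      also have "conj_by w (1\<^sub>m 1) = w * adj w" using w by (simp add: conj_by_def)
      finally show ?thesis .
    qed
    then have "msum m m (\<lambda>i. conj_by (w * R i) X) {..<n} = (\<Sum>i<n. conj_by B X $$ (i,i)) \<cdot>\<^sub>m (w * adj w)"
      using w by (intro eq_matI) (auto simp: sum_distrib_right simp del: index_mult_mat(1))
    also have "(\<Sum>i<n. conj_by B X $$ (i,i)) = mtrace (conj_by B X)"
      using conj_by_carrier[OF Bc X] by (simp add: mtrace_def)
    also have "\<dots> = mtrace (E * X)"
      by (simp add: mtrace_conj_by[OF Bc X] psd_adj[OF B(1)] B(2))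
    finally show ?thesis .
  qed
  ultimately show ?thesis using completely_positive_cong by (metis (no_types, lifting))
qed

text \<open>Trace preservation combines completeness of the effects with the unit length of the
  prepared states; complete positivity holds outcome by outcome.\<close>

lemma cptp_measure_prepare:
  assumes E: "\<And>g. g \<in> S \<Longrightarrow> psd n (E g)" "msum n n E S = 1\<^sub>m n"
    and w: "\<And>g. g \<in> S \<Longrightarrow> w g \<in> carrier_mat m 1" "\<And>g. g \<in> S \<Longrightarrow> adj (w g) * w g = 1\<^sub>m 1"
  shows "cptp n m (\<lambda>X. msum m m (\<lambda>g. mtrace (E g * X) \<cdot>\<^sub>m (w g * adj (w g))) S)"
  unfolding cptp_def lin_map_def
proof (intro conjI ballI allI)
  have Ec: "E g \<in> carrier_mat n n" if "g \<in> S" for g using E(1)[OF that] by (rule psd_carrier)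
  have F: "w g * adj (w g) \<in> carrier_mat m m" if "g \<in> S" for g using w(1)[OF that] by auto
  show "completely_positive n m (\<lambda>X. msum m m (\<lambda>g. mtrace (E g * X) \<cdot>\<^sub>m (w g * adj (w g))) S)"
    by (intro completely_positive_msum completely_positive_measure_prepare E w)
  fix X :: "complex mat" assume X: "X \<in> carrier_mat n n"
  have tF: "mtrace (w g * adj (w g)) = 1" if "g \<in> S" for g
    using w[OF that] by (subst mtrace_comm[of _ m 1]) auto
  have "mtrace (msum m m (\<lambda>g. mtrace (E g * X) \<cdot>\<^sub>m (w g * adj (w g))) S) = (\<Sum>g\<in>S. mtrace (E g * X))"
    using F tF by (subst mtrace_msum) (auto simp: mtrace_smult[OF F])
  also have "\<dots> = mtrace (msum n n E S * X)"
    by (subst msum_mult_right[OF X Ec]) (auto intro!: mtrace_msum[symmetric] mult_carrier_mat[OF Ec X])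
  finally show "mtrace (msum m m (\<lambda>g. mtrace (E g * X) \<cdot>\<^sub>m (w g * adj (w g))) S) = mtrace X"
    using X by (simp add: E(2))
  show "msum m m (\<lambda>g. mtrace (E g * (c \<cdot>\<^sub>m X)) \<cdot>\<^sub>m (w g * adj (w g))) S
    = c \<cdot>\<^sub>m msum m m (\<lambda>g. mtrace (E g * X) \<cdot>\<^sub>m (w g * adj (w g))) S" for c
  proof (subst msum_smult[symmetric])
    show "msum m m (\<lambda>g. mtrace (E g * (c \<cdot>\<^sub>m X)) \<cdot>\<^sub>m (w g * adj (w g))) S =
      msum m m (\<lambda>g. c \<cdot>\<^sub>m (mtrace (E g * X) \<cdot>\<^sub>m (w g * adj (w g)))) S"
    proof (rule msum_cong[OF refl])
      fix g assume g: "g \<in> S"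
      have "E g * (c \<cdot>\<^sub>m X) = c \<cdot>\<^sub>m (E g * X)" using Ec[OF g] X by (simp add: mat_smult_mult)
      moreover have "E g * X \<in> carrier_mat n n" using Ec[OF g] X by auto
      ultimately show "mtrace (E g * (c \<cdot>\<^sub>m X)) \<cdot>\<^sub>m (w g * adj (w g)) = c \<cdot>\<^sub>m (mtrace (E g * X) \<cdot>\<^sub>m (w g * adj (w g)))"
        by (simp add: mtrace_smult mat_smult_smult)
    qed
  qed (use F in auto)
  fix Y :: "complex mat" assume Y: "Y \<in> carrier_mat n n"
  show "msum m m (\<lambda>g. mtrace (E g * (X + Y)) \<cdot>\<^sub>m (w g * adj (w g))) S
    = msum m m (\<lambda>g. mtrace (E g * X) \<cdot>\<^sub>m (w g * adj (w g))) S + msum m m (\<lambda>g. mtrace (E g * Y) \<cdot>\<^sub>m (w g * adj (w g))) S"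
  proof (subst msum_add[symmetric])
    show "msum m m (\<lambda>g. mtrace (E g * (X + Y)) \<cdot>\<^sub>m (w g * adj (w g))) S =
      msum m m (\<lambda>g. mtrace (E g * X) \<cdot>\<^sub>m (w g * adj (w g)) + mtrace (E g * Y) \<cdot>\<^sub>m (w g * adj (w g))) S"
    proof (rule msum_cong[OF refl])
      fix g assume g: "g \<in> S"
      have "E g * (X + Y) = E g * X + E g * Y" using Ec[OF g] X Y by (intro mult_add_distrib_mat) auto
      moreover have "E g * X \<in> carrier_mat n n" "E g * Y \<in> carrier_mat n n" using Ec[OF g] X Y by auto
      ultimately show "mtrace (E g * (X + Y)) \<cdot>\<^sub>m (w g * adj (w g)) =
        mtrace (E g * X) \<cdot>\<^sub>m (w g * adj (w g)) + mtrace (E g * Y) \<cdot>\<^sub>m (w g * adj (w g))"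
        by (simp add: mtrace_add add_smult_distrib_right_mat[OF F[OF g]])
    qed
  qed (use F in auto)
qed auto

section \<open>Gram operators of finite families of vectors\<close>

lemma mtrace_adj_mult_commute:
  assumes "x \<in> carrier_mat n m" "y \<in> carrier_mat n m"
  shows "mtrace (adj x * y) = cnj (mtrace (adj y * x))"
proof -
  have "adj (adj y * x) = adj x * y" using assms by (simp add: adj_mult)
  then show ?thesis using mtrace_adj[OF mult_carrier_mat[OF adj_carrier[OF assms(2)] assms(1)]] by simp
qed

lemma mtrace_mult_msum:
  assumes A: "A \<in> carrier_mat m n" and f: "\<And>g. g \<in> S \<Longrightarrow> f g \<in> carrier_mat n m"
  shows "mtrace (A * msum n m f S) = (\<Sum>g\<in>S. mtrace (A * f g))"
  by (subst msum_mult_left[OF A f]) (auto intro!: mtrace_msum mult_carrier_mat[OF A f])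

lemma mtrace_mult_smult:
  assumes "A \<in> carrier_mat m n" "B \<in> carrier_mat n m"
  shows "mtrace (A * (c \<cdot>\<^sub>m B)) = c * mtrace (A * B)"
proof -
  have "A * B \<in> carrier_mat m m" using assms by auto
  moreover have "A * (c \<cdot>\<^sub>m B) = c \<cdot>\<^sub>m (A * B)" using assms by (simp add: mat_smult_mult)
  ultimately show ?thesis by (simp add: mtrace_smult)
qed

text \<open>Schur's test: each product \<open>b g * b h\<close> is at most half the sum of the
  squares, and symmetry of the kernel turns both halves into the same row-sum expression.\<close>

lemma double_sum_schur_bound:
  fixes k :: "'i \<Rightarrow> 'i \<Rightarrow> real" and b :: "'i \<Rightarrow> real"
  assumes k: "\<And>g h. g \<in> S \<Longrightarrow> h \<in> S \<Longrightarrow> 0 \<le> k g h \<and> k g h = k h g" and s: "\<And>g. g \<in> S \<Longrightarrow> (\<Sum>h\<in>S. k g h) \<le> s"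
  shows "(\<Sum>g\<in>S. \<Sum>h\<in>S. b g * b h * k g h) \<le> s * (\<Sum>g\<in>S. (b g)\<^sup>2)"
proof -
  have "(\<Sum>g\<in>S. \<Sum>h\<in>S. b g * b h * k g h) \<le> (\<Sum>g\<in>S. \<Sum>h\<in>S. (b g)\<^sup>2 / 2 * k g h + (b h)\<^sup>2 / 2 * k g h)"
  proof (intro sum_mono)
    fix g h assume gh: "g \<in> S" "h \<in> S"
    have "b g * b h \<le> (b g)\<^sup>2 / 2 + (b h)\<^sup>2 / 2" using sum_squares_bound[of "b g" "b h"] by simp
    then have "b g * b h * k g h \<le> ((b g)\<^sup>2 / 2 + (b h)\<^sup>2 / 2) * k g h"
      using k[OF gh] by (intro mult_right_mono) auto
    then show "b g * b h * k g h \<le> (b g)\<^sup>2 / 2 * k g h + (b h)\<^sup>2 / 2 * k g h" by (simp add: distrib_right)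
  qed
  also have "\<dots> = (\<Sum>g\<in>S. \<Sum>h\<in>S. (b g)\<^sup>2 / 2 * k g h) + (\<Sum>g\<in>S. \<Sum>h\<in>S. (b h)\<^sup>2 / 2 * k g h)"
    by (simp add: sum.distrib)
  also have "(\<Sum>g\<in>S. \<Sum>h\<in>S. (b h)\<^sup>2 / 2 * k g h) = (\<Sum>g\<in>S. \<Sum>h\<in>S. (b g)\<^sup>2 / 2 * k g h)"
    by (subst sum.swap) (intro sum.cong refl, use k in auto)
  also have "(\<Sum>g\<in>S. \<Sum>h\<in>S. (b g)\<^sup>2 / 2 * k g h) + (\<Sum>g\<in>S. \<Sum>h\<in>S. (b g)\<^sup>2 / 2 * k g h) = (\<Sum>g\<in>S. (b g)\<^sup>2 * (\<Sum>h\<in>S. k g h))"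
    unfolding sum.distrib[symmetric] sum_distrib_left by (intro sum.cong refl) (simp add: field_simps)
  also have "\<dots> \<le> (\<Sum>g\<in>S. (b g)\<^sup>2 * s)" using s by (intro sum_mono mult_left_mono) auto
  finally show ?thesis by (simp add: sum_distrib_left mult.commute)
qed

text \<open>Bessel's inequality for a family that need not be orthogonal; the absolute row sums of
  its Gram matrix determine the loss factor \<open>s\<close>. With \<open>t\<close> the left-hand
  side and \<open>u\<close> the sum of the \<open>v g\<close> weighted by their overlaps with
  \<open>x\<close>, Schur's test gives \<open>|u|^2 \<le> s t\<close>.\<close>

lemma gram_bessel_bound:
  assumes v: "\<And>g. g \<in> S \<Longrightarrow> v g \<in> carrier_mat n 1" and x: "x \<in> carrier_mat n 1"
    and s: "0 < s" "\<And>g. g \<in> S \<Longrightarrow> (\<Sum>h\<in>S. cmod (mtrace (adj (v g) * v h))) \<le> s"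
  shows "(\<Sum>g\<in>S. (cmod (mtrace (adj (v g) * x)))\<^sup>2) \<le> s * Re (mtrace (adj x * x))"
proof -
  define b where "b g = mtrace (adj (v g) * x)" for g
  define t where "t = (\<Sum>g\<in>S. (cmod (b g))\<^sup>2)"
  define u where "u = msum n 1 (\<lambda>g. b g \<cdot>\<^sub>m v g) S"
  have u: "u \<in> carrier_mat n 1" by (simp add: u_def)
  have ip: "mtrace (adj z * u) = (\<Sum>g\<in>S. b g * mtrace (adj z * v g))" if "z \<in> carrier_mat n 1" for z
    unfolding u_def using that v
    by (subst mtrace_mult_msum) (auto intro!: sum.cong simp: mtrace_mult_smult[of _ 1 n])
  have xu: "mtrace (adj x * u) = of_real t"
    unfolding ip[OF x] t_def of_real_sum
    by (intro sum.cong refl) (simp add: b_def mtrace_adj_mult_commute[OF x v] complex_norm_square del: of_real_power)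
  then have ux: "mtrace (adj u * x) = of_real t"
    using mtrace_adj_mult_commute[OF u x] by simp
  have "mtrace (adj u * u) = (\<Sum>g\<in>S. b g * cnj (\<Sum>h\<in>S. b h * mtrace (adj (v g) * v h)))"
    unfolding ip[OF u]
  proof (intro sum.cong refl)
    fix g assume "g \<in> S"
    then show "b g * mtrace (adj u * v g) = b g * cnj (\<Sum>h\<in>S. b h * mtrace (adj (v g) * v h))"
      by (simp only: mtrace_adj_mult_commute[OF u v] ip[OF v])
  qed
  also have "cmod \<dots> \<le> (\<Sum>g\<in>S. cmod (b g) * (\<Sum>h\<in>S. cmod (b h) * cmod (mtrace (adj (v g) * v h))))"
    by (intro sum_norm_le) (auto simp: norm_mult simp del: complex_cnj_cnj intro!: mult_left_mono sum_norm_le)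
  also have "\<dots> = (\<Sum>g\<in>S. \<Sum>h\<in>S. cmod (b g) * cmod (b h) * cmod (mtrace (adj (v g) * v h)))"
    by (simp add: sum_distrib_left mult.assoc)
  also have "\<dots> \<le> s * t"
    unfolding t_def
  proof (intro double_sum_schur_bound s(2))
    fix g h assume "g \<in> S" "h \<in> S"
    then show "0 \<le> cmod (mtrace (adj (v g) * v h)) \<and> cmod (mtrace (adj (v g) * v h)) = cmod (mtrace (adj (v h) * v g))"
      by (subst mtrace_adj_mult_commute[OF v v]) auto
  qed
  finally have uu: "Re (mtrace (adj u * u)) \<le> s * t" using complex_Re_le_cmod order_trans by blast
  \<comment> \<open>Both inner products of \<open>x\<close> and \<open>u\<close> equal
    \<open>t\<close>, so \<open>0 \<le> |z|^2 = s^2 |x|^2 - 2 s t + |u|^2\<close>. Inserting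
    \<open>|u|^2 \<le> s t\<close> leaves \<open>s (s |x|^2 - t)\<close>, which is therefore
    nonnegative.\<close>
  define z where "z = of_real s \<cdot>\<^sub>m x - u"
  have z: "z \<in> carrier_mat n 1" using x u by (auto simp: z_def)
  have ipz: "mtrace (adj y * z) = of_real s * mtrace (adj y * x) - mtrace (adj y * u)" if y: "y \<in> carrier_mat n 1" for y
  proof -
    have "adj y * z = adj y * (of_real s \<cdot>\<^sub>m x) - adj y * u"
      unfolding z_def using x u y by (intro mult_minus_distrib_mat) auto
    moreover have "adj y * (of_real s \<cdot>\<^sub>m x) \<in> carrier_mat 1 1" "adj y * u \<in> carrier_mat 1 1"
      using x u y by auto
    ultimately show ?thesis
      by (simp only: mtrace_minus mtrace_mult_smult[OF adj_carrier[OF y] x])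
  qed
  have "mtrace (adj z * z) = of_real s * cnj (mtrace (adj x * z)) - cnj (mtrace (adj u * z))"
    by (simp add: ipz[OF z] mtrace_adj_mult_commute[OF z x] mtrace_adj_mult_commute[OF z u])
  also have "Re \<dots> = s * (s * Re (mtrace (adj x * x)) - t) - (s * t - Re (mtrace (adj u * u)))"
    by (simp add: ipz[OF x] ipz[OF u] xu ux)
  finally have "0 \<le> s * (s * Re (mtrace (adj x * x)) - t) - (s * t - Re (mtrace (adj u * u)))"
    using mtrace_adj_self_nonneg[OF z] by simp
  then have "0 \<le> s * (s * Re (mtrace (adj x * x)) - t)" using uu by linarith
  then have "t \<le> s * Re (mtrace (adj x * x))" using s(1) by (simp add: zero_le_mult_iff)
  then show ?thesis by (simp add: t_def b_def)
qed

lemma mtrace_mult_adj_1_1: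
  assumes "A \<in> carrier_mat 1 1"
  shows "mtrace (A * adj A) = of_real ((cmod (mtrace A))\<^sup>2)"
  using assms mtrace_adj_self[of "adj A" 1 1] by (simp add: mtrace_def)

text \<open>Operator form of \<open>gram_bessel_bound\<close>: the quadratic form of the summed
  projections at \<open>y\<close> is the sum of the squared overlaps with
  \<open>adj y\<close>.\<close>

lemma psd_gram_bound:
  assumes v: "\<And>g. g \<in> S \<Longrightarrow> v g \<in> carrier_mat n 1"
    and s: "0 < s" "\<And>g. g \<in> S \<Longrightarrow> (\<Sum>h\<in>S. cmod (mtrace (adj (v g) * v h))) \<le> s"
  shows "psd n (of_real s \<cdot>\<^sub>m 1\<^sub>m n - msum n n (\<lambda>g. v g * adj (v g)) S)"
  unfolding psd_iff
proof (intro conjI ballI)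
  define M where "M = msum n n (\<lambda>g. v g * adj (v g)) S"
  have M: "M \<in> carrier_mat n n" by (simp add: M_def)
  have P: "v g * adj (v g) \<in> carrier_mat n n" if "g \<in> S" for g using v[OF that] by auto
  have "psd n M" unfolding M_def by (intro psd_msum psd_outer[where m=1] v)
  then show "adj (of_real s \<cdot>\<^sub>m 1\<^sub>m n - M) = of_real s \<cdot>\<^sub>m 1\<^sub>m n - M"
    using M by (simp add: adj_minus[of _ n n] adj_smult psd_adj)
  fix y :: "complex mat" assume y: "y \<in> carrier_mat 1 n"
  have 1: "mtrace (conj_by y M) = (\<Sum>g\<in>S. mtrace (conj_by y (v g * adj (v g))))"
    unfolding M_def using y P by (subst conj_by_msum[OF y]) (auto intro!: mtrace_msum)
  have 2: "mtrace (conj_by y (v g * adj (v g))) = of_real ((cmod (mtrace (adj (v g) * adj y)))\<^sup>2)" if "g \<in> S" for g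
  proof -
    note vg = v[OF that]
    have yv: "y * v g \<in> carrier_mat 1 1" using y vg by auto
    have "conj_by y (v g * adj (v g)) = (y * v g) * adj (y * v g)"
      using y vg by (simp add: conj_by_def adj_mult mat_mult_assoc)
    moreover have "mtrace (adj (v g) * adj y) = cnj (mtrace (y * v g))"
      using y vg mtrace_adj[OF yv] by (simp add: adj_mult)
    ultimately show ?thesis using mtrace_mult_adj_1_1[OF yv] by simp
  qed
  have "conj_by y (of_real s \<cdot>\<^sub>m 1\<^sub>m n - M) = of_real s \<cdot>\<^sub>m conj_by y (1\<^sub>m n) - conj_by y M"
    using y M by (simp add: conj_by_minus[OF y] conj_by_smult_right[OF y])
  then have "mtrace (conj_by y (of_real s \<cdot>\<^sub>m 1\<^sub>m n - M)) = of_real s * mtrace (conj_by y (1\<^sub>m n)) - mtrace (conj_by y M)"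
    by (simp only: mtrace_minus[OF smult_carrier_mat[OF conj_by_carrier[OF y one_carrier_mat]] conj_by_carrier[OF y M]]
        mtrace_smult[OF conj_by_carrier[OF y one_carrier_mat]])
  also have "mtrace (conj_by y (1\<^sub>m n)) = mtrace (adj (adj y) * adj y)" using y by (simp add: conj_by_def)
  also have "mtrace (conj_by y M) = of_real (\<Sum>g\<in>S. (cmod (mtrace (adj (v g) * adj y)))\<^sup>2)"
    unfolding 1 by (simp add: 2)
  finally show "0 \<le> Re (mtrace (conj_by y (of_real s \<cdot>\<^sub>m 1\<^sub>m n - M)))"
    using gram_bessel_bound[of S v n "adj y" s, OF v _ s] y by simp
qed auto

section \<open>Covariant channels\<close>

lemma proj_unitary_rep_unitary: "proj_unitary_rep G n V \<Longrightarrow> g \<in> carrier G \<Longrightarrow> unitary_mat n (V g)"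
  by (simp add: proj_unitary_rep_def)

lemma proj_unitary_rep_mult:
  assumes "proj_unitary_rep G n V" "g \<in> carrier G" "h \<in> carrier G"
  obtains c where "cmod c = 1" "V g * V h = c \<cdot>\<^sub>m V (g \<otimes>\<^bsub>G\<^esub> h)"
proof -
  obtain \<omega> :: "'a \<Rightarrow> 'a \<Rightarrow> real" where "V g * V h = exp (\<i> * complex_of_real (\<omega> g h)) \<cdot>\<^sub>m V (g \<otimes>\<^bsub>G\<^esub> h)"
    using assms unfolding proj_unitary_rep_def by blast
  moreover have "cmod (exp (\<i> * complex_of_real (\<omega> g h))) = 1" by simp
  ultimately show ?thesis using that by blast
qed

text \<open>The projective phase meets its own conjugate, so conjugation is a genuine group action
  on matrices.\<close>

lemma conj_by_proj_unitary_rep: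
  assumes G: "group G" and V: "proj_unitary_rep G n V" and g: "g \<in> carrier G" and h: "h \<in> carrier G"
    and X: "X \<in> carrier_mat n n"
  shows "conj_by (V g) (conj_by (V h) X) = conj_by (V (g \<otimes>\<^bsub>G\<^esub> h)) X"
proof -
  obtain c where c: "cmod c = 1" "V g * V h = c \<cdot>\<^sub>m V (g \<otimes>\<^bsub>G\<^esub> h)"
    using proj_unitary_rep_mult[OF V g h] .
  have gh: "g \<otimes>\<^bsub>G\<^esub> h \<in> carrier G" using G g h by (simp add: group.is_monoid monoid.m_closed)
  note car = unitary_mat_carrier[OF proj_unitary_rep_unitary[OF V]]
  have "c * cnj c = 1" using c(1) by (simp flip: complex_norm_square)
  then have "conj_by (c \<cdot>\<^sub>m V (g \<otimes>\<^bsub>G\<^esub> h)) X = conj_by (V (g \<otimes>\<^bsub>G\<^esub> h)) X"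
    using conj_by_carrier[OF car[OF gh] X] by (simp add: conj_by_smult[OF car[OF gh] X])
  then show ?thesis using c(2) by (simp add: conj_by_conj_by[OF car[OF g] car[OF h] X])
qed

text \<open>Overlaps are functions of \<open>inv g h\<close> only up to a phase, which is why moduli
  are compared.\<close>

lemma proj_unitary_rep_overlap:
  assumes G: "group G" and V: "proj_unitary_rep G n V" and g: "g \<in> carrier G" and h: "h \<in> carrier G"
    and v: "v \<in> carrier_mat n 1"
  shows "cmod (mtrace (adj (V g * v) * (V h * v))) = cmod (mtrace (adj v * V (inv\<^bsub>G\<^esub> g \<otimes>\<^bsub>G\<^esub> h) * v))"
proof -
  interpret group G by (rule G)
  let ?k = "inv\<^bsub>G\<^esub> g \<otimes>\<^bsub>G\<^esub> h"
  have k: "?k \<in> carrier G" using g h by simp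
  note car = unitary_mat_carrier[OF proj_unitary_rep_unitary[OF V]]
  \<comment> \<open>Multiplying from the left by \<open>V g\<close> produces a single phase; no
    comparison of \<open>V\<close> at the inverse of \<open>g\<close> with \<open>adj (V g)\<close>
    is required.\<close>
  obtain c where c: "cmod c = 1" "V g * V ?k = c \<cdot>\<^sub>m V (g \<otimes>\<^bsub>G\<^esub> ?k)"
    using proj_unitary_rep_mult[OF V g k] .
  have gk: "g \<otimes>\<^bsub>G\<^esub> ?k = h" using g h by (simp flip: m_assoc)
  have "adj (V g) * (V g * V ?k) = V ?k"
    using car[OF g] car[OF k] unitary_mat_adj_left[OF proj_unitary_rep_unitary[OF V g]]
    by (simp flip: mat_mult_assoc)
  then have Vk: "V ?k = c \<cdot>\<^sub>m (adj (V g) * V h)"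
    unfolding c(2) gk using car[OF g] car[OF h] by (simp add: mat_smult_mult)
  have "adj v * V ?k * v = c \<cdot>\<^sub>m (adj (V g * v) * (V h * v))"
    unfolding Vk using car[OF g] car[OF h] v by (simp add: mat_smult_mult adj_mult mat_mult_assoc)
  moreover have "adj (V g * v) * (V h * v) \<in> carrier_mat 1 1"
    using car[OF g] car[OF h] v by (intro mult_carrier_mat[of _ 1 n] adj_carrier) auto
  ultimately show ?thesis using c(1) by (simp only: mtrace_smult norm_mult mult_1)
qed

lemma msum_subset_diff:
  assumes "finite T" "S \<subseteq> T"
  shows "msum n m f T = msum n m f S + msum n m f (T - S)"
  using assms by (intro eq_matI) (auto simp: sum.subset_diff[OF assms(2,1)] add.commute)

lemma outer_eq_conj_by:
  assumes "V \<in> carrier_mat n n" "v \<in> carrier_mat n 1"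
  shows "(V * v) * adj (V * v) = conj_by V (v * adj v)"
  using assms by (simp add: conj_by_def adj_mult mat_mult_assoc)

lemma adj_mult_self_unitary:
  assumes "unitary_mat n V" "v \<in> carrier_mat n 1"
  shows "adj (V * v) * (V * v) = adj v * v"
proof -
  have "adj (V * v) * (V * v) = adj v * ((adj V * V) * v)"
    using unitary_mat_carrier[OF assms(1)] assms(2) by (simp add: adj_mult mat_mult_assoc)
  then show ?thesis using assms by (simp add: unitary_mat_adj_left)
qed

text \<open>The effects \<open>P g / s + (1 - M / s) / |G|\<close>, where \<open>M\<close> is the sum of the orbit projections
  \<open>P g\<close>, form a covariant measurement because \<open>M \<le> s\<close>; on outcome \<open>g\<close> the channel
  prepares the state \<open>W g w\<close>.\<close>

lemma covariant_measure_prepare: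
  fixes G :: "('g,'b) monoid_scheme"
  assumes G: "group G" and fin: "finite (carrier G)"
    and V: "proj_unitary_rep G n V" and W: "proj_unitary_rep G m W"
    and v: "v \<in> carrier_mat n 1" "adj v * v = 1\<^sub>m 1" and w: "w \<in> carrier_mat m 1" "adj w * w = 1\<^sub>m 1"
    and H: "H \<subseteq> carrier G" "\<And>g. g \<in> H \<Longrightarrow> cmod (mtrace (adj v * V g * v)) = 1"
      "\<And>g. g \<in> H \<Longrightarrow> conj_by (W g) (w * adj w) = w * adj w"
  obtains L where "cptp n m L" "covariant G n V W L"
    "trace_dist (w * adj w) (L (v * adj v)) \<le> 1 - real (card H) / (\<Sum>g\<in>carrier G. cmod (mtrace (adj v * V g * v)))"
proof -
  interpret group G by (rule G)
  define s where "s = (\<Sum>g\<in>carrier G. cmod (mtrace (adj v * V g * v)))"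
  define N where "N = card (carrier G)"
  have N: "N > 0" using fin one_closed by (auto simp: N_def card_gt_0_iff)
  note Vc = unitary_mat_carrier[OF proj_unitary_rep_unitary[OF V]]
  note Wc = unitary_mat_carrier[OF proj_unitary_rep_unitary[OF W]]
  have reindex: "(\<lambda>g. h \<otimes>\<^bsub>G\<^esub> g) ` carrier G = carrier G" "inj_on (\<lambda>g. h \<otimes>\<^bsub>G\<^esub> g) (carrier G)" if "h \<in> carrier G" for h
    using that surj_const_mult inj_on_cmult by auto
  have Vv: "V g * v \<in> carrier_mat n 1" if "g \<in> carrier G" for g using Vc[OF that] v by auto
  have Ww: "W g * w \<in> carrier_mat m 1" if "g \<in> carrier G" for g using Wc[OF that] w by auto
  \<comment> \<open>Left translation permutes the group, so every row of the Gram matrix has the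
    same absolute sum. This is the bound fed to Schur's test.\<close>
  have row: "(\<Sum>h\<in>carrier G. cmod (mtrace (adj (V g * v) * (V h * v)))) = s" if g: "g \<in> carrier G" for g
  proof -
    have "(\<Sum>h\<in>carrier G. cmod (mtrace (adj (V g * v) * (V h * v))))
      = (\<Sum>h\<in>carrier G. cmod (mtrace (adj v * V (inv\<^bsub>G\<^esub> g \<otimes>\<^bsub>G\<^esub> h) * v)))"
      by (intro sum.cong refl proj_unitary_rep_overlap[OF G V g _ v(1)])
    also have "\<dots> = s"
      unfolding s_def using g
      by (subst (2) reindex(1)[of "inv\<^bsub>G\<^esub> g", symmetric]) (simp_all add: sum.reindex reindex(2))
    finally show ?thesis .
  qed
  \<comment> \<open>The diagonal term of the row at the identity is already 1, by unitarity alone,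
    even if \<open>V \<one>\<close> is a nontrivial phase.\<close>
  have s: "s \<ge> 1"
  proof -
    have "cmod (mtrace (adj (V \<one>\<^bsub>G\<^esub> * v) * (V \<one>\<^bsub>G\<^esub> * v))) \<le> (\<Sum>h\<in>carrier G. cmod (mtrace (adj (V \<one>\<^bsub>G\<^esub> * v) * (V h * v))))"
      using fin by (intro member_le_sum) auto
    then show ?thesis
      unfolding row[OF one_closed] adj_mult_self_unitary[OF proj_unitary_rep_unitary[OF V one_closed] v(1)] v(2) by simp
  qed
  define P where "P g = (V g * v) * adj (V g * v)" for g
  define F where "F g = (W g * w) * adj (W g * w)" for g
  have P: "P g \<in> carrier_mat n n" if "g \<in> carrier G" for g using psd_carrier[OF psd_outer[OF Vv[OF that]]] by (simp add: P_def)
  have F: "F g \<in> carrier_mat m m" if "g \<in> carrier G" for g using psd_carrier[OF psd_outer[OF Ww[OF that]]] by (simp add: F_def)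
  have P0: "v * adj v \<in> carrier_mat n n" and F0: "w * adj w \<in> carrier_mat m m" using v w by auto
  have conjP: "conj_by (V h) (P g) = P (h \<otimes>\<^bsub>G\<^esub> g)" if "h \<in> carrier G" "g \<in> carrier G" for h g
    using that by (simp only: P_def outer_eq_conj_by[OF Vc v(1)] m_closed conj_by_proj_unitary_rep[OF G V _ _ P0])
  have conjF: "conj_by (W h) (F g) = F (h \<otimes>\<^bsub>G\<^esub> g)" if "h \<in> carrier G" "g \<in> carrier G" for h g
    using that by (simp only: F_def outer_eq_conj_by[OF Wc w(1)] m_closed conj_by_proj_unitary_rep[OF G W _ _ F0])
  define M where "M = msum n n P (carrier G)"
  have M: "M \<in> carrier_mat n n" by (simp add: M_def)
  define Q where "Q = of_real s \<cdot>\<^sub>m 1\<^sub>m n - M"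
  have psdQ: "psd n Q"
    unfolding Q_def M_def P_def using s row by (intro psd_gram_bound Vv) auto
  note Q = psd_carrier[OF psdQ]
  have conjM: "conj_by (V h) M = M" if h: "h \<in> carrier G" for h
  proof -
    have "conj_by (V h) M = msum n n (\<lambda>g. conj_by (V h) (P g)) (carrier G)"
      unfolding M_def by (rule conj_by_msum[OF Vc[OF h] P])
    also have "\<dots> = msum n n (\<lambda>g. P (h \<otimes>\<^bsub>G\<^esub> g)) (carrier G)"
      by (rule msum_cong[OF refl conjP[OF h]])
    also have "\<dots> = msum n n P ((\<lambda>g. h \<otimes>\<^bsub>G\<^esub> g) ` carrier G)"
      by (rule msum_reindex[symmetric, OF reindex(2)[OF h]])
    finally show ?thesis by (simp add: M_def reindex(1)[OF h])
  qed
  have conjQ: "conj_by (V h) Q = Q" if h: "h \<in> carrier G" for h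
  proof -
    have "conj_by (V h) (1\<^sub>m n) = 1\<^sub>m n"
      using Vc[OF h] unitary_mat_adj_right[OF proj_unitary_rep_unitary[OF V h]] by (simp add: conj_by_def)
    then show ?thesis
      unfolding Q_def using M
      by (simp add: conj_by_minus[OF Vc[OF h]] conj_by_smult_right[OF Vc[OF h]] conjM[OF h])
  qed
  define E where "E g = of_real (1 / s) \<cdot>\<^sub>m P g + of_real (1 / (N * s)) \<cdot>\<^sub>m Q" for g
  have psdE: "psd n (E g)" if "g \<in> carrier G" for g
    unfolding E_def P_def using s by (intro psd_add psd_smult psd_outer[OF Vv[OF that]] psdQ) auto
  note Ec = psd_carrier[OF psdE]
  have conjE: "conj_by (V h) (E g) = E (h \<otimes>\<^bsub>G\<^esub> g)" if "h \<in> carrier G" "g \<in> carrier G" for h g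
    unfolding E_def using that P[OF that(2)] Q
    by (simp add: conj_by_add[OF Vc[OF that(1)]] conj_by_smult_right[OF Vc[OF that(1)]] conjP conjQ)
  have "msum n n E (carrier G) = of_real (1 / s) \<cdot>\<^sub>m M + msum n n (\<lambda>_. of_real (1 / (N * s)) \<cdot>\<^sub>m Q) (carrier G)"
    unfolding E_def M_def using P Q by (subst msum_add) (auto simp: msum_smult)
  also have "\<dots> = 1\<^sub>m n"
  proof (rule eq_matI)
    fix i j assume "i < dim_row (1\<^sub>m n :: complex mat)" "j < dim_col (1\<^sub>m n :: complex mat)"
    then have ij: "i < n" "j < n" by auto
    have "Q $$ (i,j) = of_real s * 1\<^sub>m n $$ (i,j) - M $$ (i,j)" using ij M by (simp add: Q_def)
    then show "(of_real (1 / s) \<cdot>\<^sub>m M + msum n n (\<lambda>_. of_real (1 / (N * s)) \<cdot>\<^sub>m Q) (carrier G)) $$ (i,j) = 1\<^sub>m n $$ (i,j)"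
      using ij M Q s N by (simp add: N_def[symmetric] field_simps)
  qed (use M in auto)
  finally have sumE: "msum n n E (carrier G) = 1\<^sub>m n" .
  define L where "L X = msum m m (\<lambda>g. mtrace (E g * X) \<cdot>\<^sub>m F g) (carrier G)" for X
  have unitW: "adj (W g * w) * (W g * w) = 1\<^sub>m 1" if "g \<in> carrier G" for g
    using adj_mult_self_unitary[OF proj_unitary_rep_unitary[OF W that] w(1)] w(2) by simp
  have cptp: "cptp n m L"
    using cptp_measure_prepare[of "carrier G" n E "\<lambda>g. W g * w" m, OF psdE sumE Ww unitW]
    by (simp add: L_def[abs_def] F_def)
  have cov: "covariant G n V W L"
    unfolding covariant_def
  proof (intro ballI)
    fix h and X :: "complex mat" assume h: "h \<in> carrier G" and X: "X \<in> carrier_mat n n"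
    have tr: "mtrace (E (h \<otimes>\<^bsub>G\<^esub> g) * conj_by (V h) X) = mtrace (E g * X)" if g: "g \<in> carrier G" for g
    proof -
      have "E (h \<otimes>\<^bsub>G\<^esub> g) * conj_by (V h) X = conj_by (V h) (E g * X)"
        using conjE[OF h g] conj_by_mult_unitary[OF proj_unitary_rep_unitary[OF V h] Ec[OF g] X] by simp
      then show ?thesis
        using mtrace_conj_by_unitary[OF proj_unitary_rep_unitary[OF V h] mult_carrier_mat[OF Ec[OF g] X]] by simp
    qed
    have "L (conj_by (V h) X) = msum m m (\<lambda>g. mtrace (E g * conj_by (V h) X) \<cdot>\<^sub>m F g) ((\<lambda>g. h \<otimes>\<^bsub>G\<^esub> g) ` carrier G)"
      by (simp add: L_def reindex(1)[OF h])
    also have "\<dots> = msum m m (\<lambda>g. mtrace (E (h \<otimes>\<^bsub>G\<^esub> g) * conj_by (V h) X) \<cdot>\<^sub>m F (h \<otimes>\<^bsub>G\<^esub> g)) (carrier G)"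
      by (rule msum_reindex[OF reindex(2)[OF h]])
    also have "\<dots> = msum m m (\<lambda>g. conj_by (W h) (mtrace (E g * X) \<cdot>\<^sub>m F g)) (carrier G)"
      by (rule msum_cong[OF refl]) (simp add: tr conjF[OF h] conj_by_smult_right[OF Wc[OF h] F])
    also have "\<dots> = conj_by (W h) (L X)"
      unfolding L_def by (rule conj_by_msum[symmetric, OF Wc[OF h]]) (use F in auto)
    finally show "L (conj_by (V h) X) = conj_by (W h) (L X)" .
  qed
  define q where "q g = mtrace (conj_by (adj v) (E g))" for g
  have q: "mtrace (E g * (v * adj v)) = q g" if "g \<in> carrier G" for g
  proof -
    have "mtrace (E g * (v * adj v)) = mtrace ((E g * v) * adj v)"
      using Ec[OF that] v(1) by (simp add: mat_mult_assoc)
    also have "\<dots> = mtrace (adj v * (E g * v))"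
      using Ec[OF that] v(1) by (intro mtrace_comm[of _ n 1]) auto
    finally show ?thesis using Ec[OF that] v(1) by (simp add: q_def conj_by_def mat_mult_assoc)
  qed
  have q_nonneg: "Im (q g) = 0 \<and> 0 \<le> Re (q g)" if "g \<in> carrier G" for g
    using psd_mtrace[OF psd_conj_by[OF psdE[OF that] adj_carrier[OF v(1)]]] by (simp add: q_def)
  then have q_real: "q g = of_real (Re (q g))" if "g \<in> carrier G" for g using that by (simp add: complex_eq_iff)
  have traceF: "mtrace (F g) = 1" if "g \<in> carrier G" for g
    unfolding F_def using unitW[OF that] mtrace_comm[OF Ww[OF that] adj_carrier[OF Ww[OF that]]] by simp
  have "mtrace (v * adj v) = 1" using mtrace_comm[OF v(1) adj_carrier[OF v(1)]] v(2) by simp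
  moreover have "mtrace (L (v * adj v)) = mtrace (v * adj v)" using cptp P0 by (simp add: cptp_def)
  moreover have "mtrace (L (v * adj v)) = (\<Sum>g\<in>carrier G. q g)"
    unfolding L_def by (subst mtrace_msum) (use F in \<open>auto simp: mtrace_smult[OF F] q traceF\<close>)
  ultimately have sum_q: "(\<Sum>g\<in>carrier G. Re (q g)) = 1" by (simp flip: Re_sum)
  \<comment> \<open>For \<open>g\<close> in \<open>H\<close> the overlap of \<open>V g * v\<close>
    with \<open>v\<close> has modulus one, so \<open>P g\<close> has expectation 1 in
    \<open>v\<close>. The share of \<open>Q\<close> only adds to the probability.\<close>
  have q_H: "1 / s \<le> Re (q g)" if "g \<in> H" for g
  proof -
    have g: "g \<in> carrier G" using that H(1) by auto
    note av = adj_carrier[OF v(1)]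
    have "conj_by (adj v) (E g) = of_real (1 / s) \<cdot>\<^sub>m conj_by (adj v) (P g) + of_real (1 / (N * s)) \<cdot>\<^sub>m conj_by (adj v) Q"
      unfolding E_def using P[OF g] Q
      by (simp only: conj_by_add[OF av] conj_by_smult_right[OF av] smult_carrier_mat)
    then have "q g = of_real (1 / s) * mtrace (conj_by (adj v) (P g)) + of_real (1 / (N * s)) * mtrace (conj_by (adj v) Q)"
      unfolding q_def
      by (simp only: mtrace_add[OF smult_carrier_mat[OF conj_by_carrier[OF av P[OF g]]] smult_carrier_mat[OF conj_by_carrier[OF av Q]]]
          mtrace_smult[OF conj_by_carrier[OF av P[OF g]]] mtrace_smult[OF conj_by_carrier[OF av Q]])
    moreover have "mtrace (conj_by (adj v) (P g)) = 1"
    proof -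
      have A: "adj v * V g * v \<in> carrier_mat 1 1" using v(1) Vc[OF g] by auto
      have "conj_by (adj v) (P g) = (adj v * V g * v) * adj (adj v * V g * v)"
        using v(1) Vc[OF g] by (simp add: P_def conj_by_def adj_mult mat_mult_assoc)
      then show ?thesis using mtrace_mult_adj_1_1[OF A] H(2)[OF that] by simp
    qed
    moreover have "Im (mtrace (conj_by (adj v) Q)) = 0" "0 \<le> Re (mtrace (conj_by (adj v) Q))"
      using psd_mtrace[OF psd_conj_by[OF psdQ av]] by auto
    ultimately show ?thesis using s by (simp add: divide_simps)
  qed
  \<comment> \<open>\<open>p\<close> is the probability of an outcome in \<open>H\<close>, where the
    prepared state is exactly the target; \<open>R\<close> is the unnormalized output of all other
    outcomes.\<close>
  define p where "p = (\<Sum>g\<in>H. Re (q g))"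
  define R where "R = msum m m (\<lambda>g. of_real (Re (q g)) \<cdot>\<^sub>m F g) (carrier G - H)"
  have finH: "finite H" using H(1) fin finite_subset by blast
  have split: "p + (\<Sum>g\<in>carrier G - H. Re (q g)) = 1"
    unfolding p_def using sum.subset_diff[OF H(1) fin, of "\<lambda>g. Re (q g)"] sum_q by simp
  have p1: "p \<le> 1" using split sum_nonneg[of "carrier G - H" "\<lambda>g. Re (q g)"] q_nonneg by auto
  have psdR: "psd m R"
    unfolding R_def F_def using q_nonneg by (intro psd_msum psd_smult psd_outer[OF Ww]) auto
  have "mtrace R = (\<Sum>g\<in>carrier G - H. of_real (Re (q g)))"
    unfolding R_def by (subst mtrace_msum) (use F in \<open>auto simp: mtrace_smult[OF F] traceF\<close>)
  then have trR: "Re (mtrace R) = 1 - p" using split by simp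
  have FH: "F g = w * adj w" if "g \<in> H" for g
    using that H(1) H(3)[OF that] outer_eq_conj_by[OF Wc w(1), of g] by (auto simp: F_def)
  have "L (v * adj v) = msum m m (\<lambda>g. of_real (Re (q g)) \<cdot>\<^sub>m F g) (carrier G)"
    unfolding L_def by (rule msum_cong[OF refl]) (simp add: q flip: q_real)
  also have "\<dots> = msum m m (\<lambda>g. of_real (Re (q g)) \<cdot>\<^sub>m F g) H + R"
    unfolding R_def by (rule msum_subset_diff[OF fin H(1)])
  also have "msum m m (\<lambda>g. of_real (Re (q g)) \<cdot>\<^sub>m F g) H = of_real p \<cdot>\<^sub>m (w * adj w)"
    using F0 by (intro eq_matI) (auto simp: FH p_def sum_distrib_right simp del: index_mult_mat(1))
  finally have "L (v * adj v) = of_real p \<cdot>\<^sub>m (w * adj w) + R" .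
  \<comment> \<open>The error is a difference of two positive matrices, each of trace
    \<open>1 - p\<close>. Its trace norm is thus at most \<open>2 * (1 - p)\<close>, and the factor
    2 cancels in \<open>trace_dist\<close>.\<close>
  then have "w * adj w - L (v * adj v) = of_real (1 - p) \<cdot>\<^sub>m (w * adj w) - R"
    using F0 psd_carrier[OF psdR] by (intro eq_matI) (auto simp: algebra_simps simp del: index_mult_mat(1))
  moreover have "psd m (of_real (1 - p) \<cdot>\<^sub>m (w * adj w))"
    using p1 by (intro psd_smult psd_outer[OF w(1)]) auto
  moreover have "mtrace (of_real (1 - p) \<cdot>\<^sub>m (w * adj w)) = of_real (1 - p)"
    using mtrace_comm[OF w(1) adj_carrier[OF w(1)]] w(2) by (simp add: mtrace_smult[OF F0])
  ultimately have "trace_norm (w * adj w - L (v * adj v)) \<le> 2 * (1 - p)"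
    using trace_norm_minus_le[OF _ psdR, of "of_real (1 - p) \<cdot>\<^sub>m (w * adj w)"] trR by simp
  moreover have "real (card H) / s \<le> p"
    using sum_mono[of H "\<lambda>_. 1 / s" "\<lambda>g. Re (q g)"] q_H by (simp add: p_def)
  ultimately have "trace_dist (w * adj w) (L (v * adj v)) \<le> 1 - real (card H) / s"
    by (simp add: trace_dist_def)
  then show ?thesis using that cptp cov by (simp add: s_def)
qed

text \<open>The phases of the \<open>N\<close> factors multiply, so the real cocycle is scaled by
  \<open>N\<close>.\<close>

lemma proj_unitary_rep_tpow:
  assumes "proj_unitary_rep G d U"
  shows "proj_unitary_rep G (d ^ N) (\<lambda>g. tpow N (U g))"
proof -
  obtain \<omega> :: "'a \<Rightarrow> 'a \<Rightarrow> real" where U: "\<And>g. g \<in> carrier G \<Longrightarrow> unitary_mat d (U g)"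
    and \<omega>: "\<And>g h. g \<in> carrier G \<Longrightarrow> h \<in> carrier G \<Longrightarrow> U g * U h = exp (\<i> * complex_of_real (\<omega> g h)) \<cdot>\<^sub>m U (g \<otimes>\<^bsub>G\<^esub> h)"
    using assms unfolding proj_unitary_rep_def by blast
  note c = unitary_mat_carrier[OF U]
  show ?thesis
    unfolding proj_unitary_rep_def
  proof (intro conjI ballI exI[of _ "\<lambda>g h. real N * \<omega> g h"])
    fix g assume g: "g \<in> carrier G"
    have "adj (tpow N (U g)) * tpow N (U g) = 1\<^sub>m (d ^ N)"
      unfolding tpow_adj[symmetric] tpow_mult[OF adj_carrier[OF c[OF g]] c[OF g], symmetric]
        unitary_mat_adj_left[OF U[OF g]] tpow_one ..
    then show "unitary_mat (d ^ N) (tpow N (U g))" using c[OF g] by (auto simp: unitary_mat_def)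
    fix h assume h: "h \<in> carrier G"
    have "exp (\<i> * complex_of_real (\<omega> g h)) ^ N = exp (\<i> * complex_of_real (real N * \<omega> g h))"
      by (simp flip: exp_of_nat_mult add: mult_ac)
    then show "tpow N (U g) * tpow N (U h) = exp (\<i> * complex_of_real (real N * \<omega> g h)) \<cdot>\<^sub>m tpow N (U (g \<otimes>\<^bsub>G\<^esub> h))"
      unfolding tpow_mult[OF c[OF g] c[OF h], symmetric] \<omega>[OF g h] tpow_smult by simp
  qed
qed

section \<open>Pure states as one-column matrices\<close>

definition col_mat :: "complex vec \<Rightarrow> complex mat" where
  "col_mat x = mat (dim_vec x) 1 (\<lambda>(i,j). x $ i)"

lemma col_mat_carrier [simp, intro]: "x \<in> carrier_vec n \<Longrightarrow> col_mat x \<in> carrier_mat n 1"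
  by (auto simp: col_mat_def)

lemma proj_eq_col_mat: "proj x = col_mat x * adj (col_mat x)"
  by (rule eq_matI) (auto simp: proj_def col_mat_def index_mult_mat_sum simp del: index_mult_mat(1))

lemma adj_mult_col_mat:
  assumes "x \<in> carrier_vec n" "vnorm x = 1"
  shows "adj (col_mat x) * col_mat x = 1\<^sub>m 1"
proof -
  have "(\<Sum>i<n. (cmod (x $ i))\<^sup>2) = 1" using assms by (simp add: vnorm_def real_sqrt_eq_1_iff)
  then have "mtrace (adj (col_mat x) * col_mat x) = 1"
    unfolding mtrace_adj_self[OF col_mat_carrier[OF assms(1)]] using assms(1) by (simp add: col_mat_def del: of_real_power of_real_sum)
  moreover have "adj (col_mat x) * col_mat x \<in> carrier_mat 1 1"
    using adj_carrier[OF col_mat_carrier[OF assms(1)]] col_mat_carrier[OF assms(1)] by (rule mult_carrier_mat)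
  ultimately show ?thesis by (intro eq_matI) (auto simp: mtrace_1_1 simp del: index_mult_mat(1))
qed

lemma chi_eq_mtrace:
  assumes x: "x \<in> carrier_vec n" and U: "proj_unitary_rep G n U" and g: "g \<in> carrier G"
  shows "chi U x g = mtrace (adj (col_mat x) * U g * col_mat x)"
proof -
  note Ug = unitary_mat_carrier[OF proj_unitary_rep_unitary[OF U g]]
  have "mtrace (adj (col_mat x) * U g * col_mat x) = mtrace (adj (col_mat x) * (U g * col_mat x))"
    using Ug x by (simp add: mat_mult_assoc col_mat_def)
  also have "\<dots> = (\<Sum>j<n. cnj (x $ j) * (U g * col_mat x) $$ (j,0))"
    by (subst mtrace_adj_mult[of _ n 1]) (use Ug x in \<open>auto simp: col_mat_def simp del: index_mult_mat(1)\<close>)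
  also have "\<dots> = chi U x g"
    using Ug x by (auto simp: chi_def col_mat_def scalar_prod_def intro!: sum.cong)
  finally show ?thesis by simp
qed

text \<open>The equality case of the Cauchy-Schwarz inequality for \<open>x\<close> and \<open>U x\<close>.\<close>

lemma unitary_overlap:
  assumes U: "unitary_mat n U" and x: "x \<in> carrier_mat n 1" "adj x * x = 1\<^sub>m 1"
  shows "cmod (mtrace (adj x * U * x)) \<le> 1"
    and "cmod (mtrace (adj x * U * x)) = 1 \<longleftrightarrow> conj_by U (x * adj x) = x * adj x"
proof -
  note Uc = unitary_mat_carrier[OF U]
  have Ux: "U * x \<in> carrier_mat n 1" using Uc x by auto
  define c where "c = mtrace (adj x * (U * x))"
  have c: "mtrace (adj x * U * x) = c" using Uc x(1) by (simp add: c_def mat_mult_assoc)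
  \<comment> \<open>The component of \<open>U * x\<close> orthogonal to \<open>x\<close>. Its
    squared length \<open>1 - |c|^2\<close> gives the bound, and its vanishing says that
    \<open>U * x\<close> is a phase multiple of \<open>x\<close>.\<close>
  define z where "z = U * x - c \<cdot>\<^sub>m x"
  have z: "z \<in> carrier_mat n 1" using Ux x by (auto simp: z_def)
  have ipz: "mtrace (adj y * z) = mtrace (adj y * (U * x)) - c * mtrace (adj y * x)" if y: "y \<in> carrier_mat n 1" for y
  proof -
    have "adj y * z = adj y * (U * x) - adj y * (c \<cdot>\<^sub>m x)"
      unfolding z_def using x Ux y by (intro mult_minus_distrib_mat) auto
    moreover have "adj y * (U * x) \<in> carrier_mat 1 1" "adj y * (c \<cdot>\<^sub>m x) \<in> carrier_mat 1 1"
      using x Ux y by auto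
    ultimately show ?thesis
      by (simp only: mtrace_minus mtrace_mult_smult[OF adj_carrier[OF y] x(1)])
  qed
  have xz: "mtrace (adj x * z) = 0" using ipz[OF x(1)] x(2) by (simp add: c_def)
  have Uxz: "mtrace (adj (U * x) * z) = 1 - c * cnj c"
    using ipz[OF Ux] mtrace_adj_mult_commute[OF Ux x(1)] adj_mult_self_unitary[OF U x(1)] x(2) by (simp add: c_def)
  have "mtrace (adj z * z) = cnj (mtrace (adj (U * x) * z)) - c * cnj (mtrace (adj x * z))"
    by (simp only: ipz[OF z] mtrace_adj_mult_commute[OF z Ux] mtrace_adj_mult_commute[OF z x(1)])
  also have "\<dots> = of_real (1 - (cmod c)\<^sup>2)"
    unfolding xz Uxz by (simp add: complex_norm_square mult.commute del: of_real_power)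
  finally have zz: "Re (mtrace (adj z * z)) = 1 - (cmod c)\<^sup>2" by simp
  then have "(cmod c)\<^sup>2 \<le> 1" using mtrace_adj_self_nonneg[OF z] by simp
  then show "cmod (mtrace (adj x * U * x)) \<le> 1" unfolding c by (simp add: power_le_one_iff)
  show "cmod (mtrace (adj x * U * x)) = 1 \<longleftrightarrow> conj_by U (x * adj x) = x * adj x"
    unfolding c
  proof
    assume c1: "cmod c = 1"
    then have "z = 0\<^sub>m n 1" using zz by (intro mtrace_adj_self_zero[OF z]) simp
    then have "(U * x - c \<cdot>\<^sub>m x) $$ (i,0) = 0" if "i < n" for i using that by (simp add: z_def)
    then have "U * x = c \<cdot>\<^sub>m x" using Ux x(1) by (intro eq_matI) (auto simp del: index_mult_mat(1))
    then have "conj_by U (x * adj x) = (c * cnj c) \<cdot>\<^sub>m (x * adj x)"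
      unfolding outer_eq_conj_by[OF Uc x(1), symmetric] using x(1)
      by (simp add: adj_smult mat_smult_mult mat_smult_smult mult.commute)
    also have "c * cnj c = 1" using c1 by (simp flip: complex_norm_square)
    finally show "conj_by U (x * adj x) = x * adj x" using x(1) by simp
  next
    assume eq: "conj_by U (x * adj x) = x * adj x"
    have A: "adj x * U * x \<in> carrier_mat 1 1" using x(1) Uc by auto
    \<comment> \<open>The squared modulus of the overlap is the expectation in \<open>x\<close> of
      the conjugated projection, hence 1 when that projection is invariant.\<close>
    have "(adj x * U * x) * adj (adj x * U * x) = adj x * conj_by U (x * adj x) * x"
      using x(1) Uc by (simp add: conj_by_def adj_mult mat_mult_assoc)
    also have "\<dots> = (adj x * x) * (adj x * x)" unfolding eq using x(1) by (simp add: mat_mult_assoc)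
    finally have "of_real ((cmod c)\<^sup>2) = (1::complex)"
      using mtrace_mult_adj_1_1[OF A] unfolding x(2) c by simp
    then have "(cmod c)\<^sup>2 = 1" by (simp only: of_real_eq_1_iff)
    then show "cmod c = 1" by (simp add: power2_eq_1_iff) (use norm_ge_zero[of c] in linarith)
  qed
qed


text \<open>A projective representation may send the identity to a phase multiple of the identity
  matrix, so only the modulus is determined. It is the overlap of \<open>U \<one> * x\<close> with
  itself.\<close>

lemma chi_one:
  assumes G: "group G" and U: "proj_unitary_rep G d U" and x: "x \<in> carrier_vec d" "vnorm x = 1"
  shows "cmod (chi U x \<one>\<^bsub>G\<^esub>) = 1"
proof -
  interpret group G by (rule G)
  note o = one_closed
  have "cmod (mtrace (adj (U \<one>\<^bsub>G\<^esub> * col_mat x) * (U \<one>\<^bsub>G\<^esub> * col_mat x))) = cmod (chi U x \<one>\<^bsub>G\<^esub>)"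
    using proj_unitary_rep_overlap[OF G U o o col_mat_carrier[OF x(1)]]
      chi_eq_mtrace[OF x(1) U o] by simp
  then show ?thesis
    using adj_mult_self_unitary[OF proj_unitary_rep_unitary[OF U o] col_mat_carrier[OF x(1)]] adj_mult_col_mat[OF x]
    by simp
qed

lemma G0_eq_SymG:
  assumes U: "proj_unitary_rep G d U" and x: "x \<in> carrier_vec d" "vnorm x = 1"
  shows "G0 G U x = SymG G U x"
proof -
  have "cmod (chi U x g) = 1 \<longleftrightarrow> conj_by (U g) (proj x) = proj x" if "g \<in> carrier G" for g
    using unitary_overlap(2)[OF proj_unitary_rep_unitary[OF U that] col_mat_carrier[OF x(1)] adj_mult_col_mat[OF x]]
      chi_eq_mtrace[OF x(1) U that]
    by (simp add: proj_eq_col_mat)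
  then show ?thesis by (auto simp: G0_def SymG_def)
qed

lemma cmod_chi_le_one:
  assumes "proj_unitary_rep G d U" "x \<in> carrier_vec d" "vnorm x = 1" "g \<in> carrier G"
  shows "cmod (chi U x g) \<le> 1"
  using unitary_overlap(1)[OF proj_unitary_rep_unitary[OF assms(1,4)] col_mat_carrier[OF assms(2)] adj_mult_col_mat[OF assms(2,3)]]
    chi_eq_mtrace[OF assms(2,1,4)]
  by simp

section \<open>Achievability of every rate\<close>

lemma conj_by_tpow:
  assumes "V \<in> carrier_mat n n" "X \<in> carrier_mat n n"
  shows "conj_by (tpow N V) (tpow N X) = tpow N (conj_by V X)"
  by (simp only: conj_by_def tpow_mult[OF mult_carrier_mat[OF assms] adj_carrier[OF assms(1)]] tpow_mult[OF assms] tpow_adj)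

lemma achievable_rate:
  assumes G: "group G" and fin: "finite (carrier G)" and U: "proj_unitary_rep G d U"
    and x: "\<psi> \<in> carrier_vec d" "vnorm \<psi> = 1" and y: "\<phi> \<in> carrier_vec d" "vnorm \<phi> = 1"
    and sub: "G0 G U \<psi> \<subseteq> G0 G U \<phi>" and r: "0 \<le> r"
  shows "r \<in> achievable_rates G d U \<psi> \<phi>"
proof -
  define H where "H = G0 G U \<psi>"
  define \<epsilon> where "\<epsilon> N = 1 - real (card H) / (\<Sum>g\<in>carrier G. cmod (chi U \<psi> g) ^ N)" for N
  note Uc = unitary_mat_carrier[OF proj_unitary_rep_unitary[OF U]]
  have H: "H \<subseteq> carrier G" "finite H" using fin by (auto simp: H_def G0_def)
  \<comment> \<open>Keeps the limit \<open>card H\<close> of the denominators away from 0, so that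
    the quotient in \<open>\<epsilon>\<close> converges to 1.\<close>
  have "\<one>\<^bsub>G\<^esub> \<in> H" using chi_one[OF G U x] G by (simp add: H_def G0_def group.is_monoid)
  then have cardH: "card H > 0" using H(2) by (auto simp: card_gt_0_iff)
  \<comment> \<open>Membership in \<open>H\<close> is modulus one, and every other modulus is
    strictly below one, so its powers die out.\<close>
  have "(\<lambda>N. cmod (chi U \<psi> g) ^ N) \<longlonglongrightarrow> (if g \<in> H then 1 else 0)" if "g \<in> carrier G" for g
    using cmod_chi_le_one[OF U x that] that by (auto simp: H_def G0_def intro: LIMSEQ_realpow_zero)
  then have "(\<lambda>N. \<Sum>g\<in>carrier G. cmod (chi U \<psi> g) ^ N) \<longlonglongrightarrow> (\<Sum>g\<in>carrier G. if g \<in> H then 1 else 0)"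
    by (intro tendsto_sum) auto
  also have "(\<Sum>g\<in>carrier G. if g \<in> H then 1 else 0) = real (card H)"
    using H(1) fin by (simp add: sum.If_cases Int_absorb1)
  finally have "\<epsilon> \<longlonglongrightarrow> 1 - real (card H) / real (card H)"
    unfolding \<epsilon>_def using cardH by (intro tendsto_intros) auto
  then have lim: "\<epsilon> \<longlonglongrightarrow> 0" using cardH by simp
  \<comment> \<open>The number \<open>M\<close> of output copies is independent of \<open>N\<close>
    and absent from the error. The rate enters only at the end, with \<open>M\<close> the floor of
    \<open>r * N\<close>.\<close>
  have "\<exists>\<Lambda>. cptp (d ^ N) (d ^ M) \<Lambda> \<and> covariant G (d ^ N) (\<lambda>g. tpow N (U g)) (\<lambda>g. tpow M (U g)) \<Lambda> \<and>
      trace_dist (tpow M (proj \<phi>)) (\<Lambda> (tpow N (proj \<psi>))) \<le> \<epsilon> N" for N M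
  proof -
    have col: "tpow K (col_mat z) \<in> carrier_mat (d ^ K) 1"
      and unit: "vnorm z = 1 \<Longrightarrow> adj (tpow K (col_mat z)) * tpow K (col_mat z) = 1\<^sub>m 1"
      and outer: "tpow K (col_mat z) * adj (tpow K (col_mat z)) = tpow K (proj z)"
      if z: "z \<in> carrier_vec d" for K z
    proof -
      note cz = col_mat_carrier[OF z]
      show "tpow K (col_mat z) \<in> carrier_mat (d ^ K) 1" using tpow_carrier[OF cz, of K] by simp
      show "tpow K (col_mat z) * adj (tpow K (col_mat z)) = tpow K (proj z)"
        by (simp only: proj_eq_col_mat tpow_mult[OF cz adj_carrier[OF cz]] tpow_adj)
      assume "vnorm z = 1"
      then show "adj (tpow K (col_mat z)) * tpow K (col_mat z) = 1\<^sub>m 1"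
        using tpow_mult[OF adj_carrier[OF cz] cz, of K] by (simp add: adj_mult_col_mat[OF z] tpow_one tpow_adj)
    qed
    have ov: "mtrace (adj (tpow N (col_mat \<psi>)) * tpow N (U g) * tpow N (col_mat \<psi>)) = chi U \<psi> g ^ N" if "g \<in> carrier G" for g
    proof -
      note cz = col_mat_carrier[OF x(1)]
      have "adj (tpow N (col_mat \<psi>)) * tpow N (U g) * tpow N (col_mat \<psi>) = tpow N (adj (col_mat \<psi>) * U g * col_mat \<psi>)"
        by (simp only: tpow_mult[OF mult_carrier_mat[OF adj_carrier[OF cz] Uc[OF that]] cz]
            tpow_mult[OF adj_carrier[OF cz] Uc[OF that]] tpow_adj)
      then show ?thesis
        using mtrace_tpow[OF mult_carrier_mat[OF mult_carrier_mat[OF adj_carrier[OF cz] Uc[OF that]] cz], of N]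
          chi_eq_mtrace[OF x(1) U that] by simp
    qed
    have H2: "cmod (mtrace (adj (tpow N (col_mat \<psi>)) * tpow N (U g) * tpow N (col_mat \<psi>))) = 1" if "g \<in> H" for g
    proof -
      have "g \<in> carrier G" "cmod (chi U \<psi> g) = 1" using that by (auto simp: H_def G0_def)
      then show ?thesis by (simp add: ov norm_power)
    qed
    have H3: "conj_by (tpow M (U g)) (tpow M (col_mat \<phi>) * adj (tpow M (col_mat \<phi>)))
      = tpow M (col_mat \<phi>) * adj (tpow M (col_mat \<phi>))" if "g \<in> H" for g
    proof -
      have "g \<in> SymG G U \<phi>" using that sub G0_eq_SymG[OF U y] by (auto simp: H_def)
      then have "g \<in> carrier G" "conj_by (U g) (proj \<phi>) = proj \<phi>" by (auto simp: SymG_def)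
      moreover have "proj \<phi> \<in> carrier_mat d d" using y by (auto simp: proj_def)
      ultimately show ?thesis unfolding outer[OF y(1)] using conj_by_tpow[OF Uc] by simp
    qed
    obtain L where "cptp (d ^ N) (d ^ M) L" "covariant G (d ^ N) (\<lambda>g. tpow N (U g)) (\<lambda>g. tpow M (U g)) L"
      "trace_dist (tpow M (col_mat \<phi>) * adj (tpow M (col_mat \<phi>))) (L (tpow N (col_mat \<psi>) * adj (tpow N (col_mat \<psi>))))
        \<le> 1 - real (card H) / (\<Sum>g\<in>carrier G. cmod (mtrace (adj (tpow N (col_mat \<psi>)) * tpow N (U g) * tpow N (col_mat \<psi>))))"
      using covariant_measure_prepare[OF G fin proj_unitary_rep_tpow[OF U, of N] proj_unitary_rep_tpow[OF U, of M]
          col[OF x(1)] unit[OF x] col[OF y(1)] unit[OF y] H(1) H2 H3] .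
    moreover have "(\<Sum>g\<in>carrier G. cmod (mtrace (adj (tpow N (col_mat \<psi>)) * tpow N (U g) * tpow N (col_mat \<psi>))))
      = (\<Sum>g\<in>carrier G. cmod (chi U \<psi> g) ^ N)"
      by (intro sum.cong refl) (simp add: ov norm_power)
    ultimately show ?thesis
      unfolding outer[OF x(1)] outer[OF y(1)] \<epsilon>_def by auto
  qed
  then show ?thesis using r lim unfolding achievable_rates_def by blast
qed

theorem theorem2:
  fixes G :: "('g,'b) monoid_scheme" and d :: nat and U :: "'g \<Rightarrow> complex mat"
    and \<psi> \<phi> :: "complex vec"
  assumes "group G" and "finite (carrier G)"
    and "proj_unitary_rep G d U"
    and "\<psi> \<in> carrier_vec d" and "vnorm \<psi> = 1"
    and "\<phi> \<in> carrier_vec d" and "vnorm \<phi> = 1"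
    and "G0 G U \<psi> \<subseteq> G0 G U \<phi>"
  shows "R_ap G d U \<psi> \<phi> = (if SymG G U \<psi> \<subseteq> SymG G U \<phi> then \<infinity> else 0)"
proof -
  have "ereal r \<le> R_ap G d U \<psi> \<phi>" for r
  proof -
    \<comment> \<open>Achievable rates are nonnegative by definition, whereas the bound is needed
      for every real \<open>r\<close> to conclude that the supremum is infinite.\<close>
    have "max r 0 \<in> achievable_rates G d U \<psi> \<phi>" using achievable_rate[OF assms] by simp
    then have "ereal (max r 0) \<le> R_ap G d U \<psi> \<phi>" unfolding R_ap_def by (intro Sup_upper imageI)
    then show ?thesis by (rule order_trans[rotated]) simp
  qed
  then have "R_ap G d U \<psi> \<phi> = \<infinity>" by (rule ereal_top)
  moreover have "SymG G U \<psi> \<subseteq> SymG G U \<phi>"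
    using assms(8) G0_eq_SymG[OF assms(3)] assms(4-7) by simp
  ultimately show ?thesis by simp
qed

end
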